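(* Let $\Gamma$ be a finite tree with $m:=m(\Gamma)\ge 1$ essential vertices, and let $n$ be an integer such that $\Gamma$ is sufficiently subdivided for $n$. Fix a planar embedding of $\Gamma$ and a root $\ast$ (a vertex of degree 1), with the induced ordering of the vertices. (1) Assume $\Gamma$ has at least one vertex of degree 3, and let $k$ be the smallest integer such that there is a collection of oriented arcs $\{A_i\}_{i=1}^k$ in $\Gamma$ which is allowable for the collection of all vertices of degree 3 in $\Gamma$ (so $k\ge 1$). Let $n\ge 2m$, and consider any two critical $m$-cells $\Phi$ and $\Psi$ of $UD^n(\Gamma)$. If $\{[c_1],\dots,[c_m]\}$ and $\{[d_1],\dots,[d_m]\}$ are the unique collections of equivalence classes of 1-cells having $[\Phi]$ and $[\Psi]$, respectively, as their least upper bounds, and $[c_i]\ne[d_j]$ for all $i$ and $j$, then $n\ge 2m+k$. (2) Let $n=2q+\epsilon<2m$ with $\epsilon\in\{0,1\}$ and $q\ge 1$, let $r$ be the number of vertices of degree greater than 3 and $s$ the number of vertices of degree 3 in $\Gamma$, and assume $s<2(q-r)$. Let $\Phi$ and $\Psi$ be critical $q$-cells of $UD^n(\Gamma)$, and let $\{[c_1],\dots,[c_q]\}$ and $\{[d_1],\dots,[d_q]\}$ be the unique collections of equivalence classes of 1-cells having $[\Phi]$ and $[\Psi]$, respectively, as their least upper bounds. If $[c_i]\ne[d_j]$ for all $i$ and $j$, then: (a) if $\epsilon=0$, there is some $k\ge 1$ such that there exist oriented arcs $A_1,\dots,A_k$ in $\Gamma$ with the following properties: (i) the endpoints of each $A_l$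 are (distinct) essential vertices, neither of which is an endpoint of any other $A_{l'}$; (ii) there are $r'\le r$ vertices of degree greater than 3 which are not the endpoints of any $A_l$ (that is, $r'$ denotes the number of such vertices); (iii) there is a collection $\mathcal{V}$ of degree-3 vertices with $|\mathcal{V}|\ge q-r'-k$ such that $\{A_i\}_{i=1}^k$ is allowable for $\mathcal{V}$; (b) if $\epsilon=1$, there is an arc $A_0$ in $\Gamma$ (with no restrictions on its endpoints) whose interior includes a collection $\mathcal{W}'$ of $s'\le q$ distinct vertices of degree 3, and, if $s'<q-r$, there are also, for some $k\ge1$, oriented arcs $A_1,\dots,A_k$ such that: the endpoints of each $A_l$ ($1\le l\le k$) are distinct essential vertices, neither of which is an endpoint of any other $A_{l'}$ ($1\le l'\le k$), and none of which is in $\mathcal{W}'$; and there is a collection $\mathcal{W}$ of degree-3 vertices with $\mathcal{W}\cap\mathcal{W}'=\emptyset$, $|\mathcal{W}|\ge q-r'-k-s'$, and $\{A_i\}_{i=1}^k$ allowable for $\mathcal{W}$, where $r'\le r$ is the number of vertices of degree greater than 3 which are not endpoints of any of $A_1,\dots,A_k$.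
   Context: A graph is a finite 1-dimensional CW complex; its 0-cells are vertices and the closures of its 1-cells are (closed) edges; "cell" of $\Gamma$ means a vertex or closed edge. A tree is a connected graph with no cycles. The degree of a vertex of a tree is the number of edges having it as an endpoint. An essential vertex is a vertex of degree at least 3; $m(\Gamma)$ is the number of essential vertices. A tree is sufficiently subdivided for $n$ if it has at least $n$ vertices and each path between distinct vertices of degree not equal to 2 contains at least $n-1$ edges. Discrete configuration spaces: $D^n(\Gamma)\subset\Gamma^n$ is the union of all products $c_1\times\cdots\times c_n$ of (closed) cells of $\Gamma$ with $c_i\cap c_j=\emptyset$ for $i\ne j$; $UD^n(\Gamma)=D^n(\Gamma)/S_n$ with $S_n$ permuting coordinates. A cell of $UD^n(\Gamma)$ is an unordered collection $c=\{c_1,\dots,c_n\}$ of pairwise disjoint cells of $\Gamma$; its dimension is the number of edges among the $c_i$. Vertex ordering: embed $\Gamma$ in the plane and choose a vertex $\ast$ of degree 1. Number $\ast$ with 0, travel away from $\ast$ and number the remaining vertices $1,2,\dots$ in the order first encountered, taking the leftmost edge at each essential vertex and turning around at degree-1 vertices (depth-first order). For an edge $e$, $\iota(e)<\tau(e)$ denote its endpoints. For $v\neq\ast$, $e_v$ is the unique edge with $\tau(e_v)=v$. The directions from a vertex $v\ne\ast$ of degree $d$ are the numbering $0,\dots,d-1$ of the incident edges clockwise around $v$, with 0 the direction towards $\ast$. Critical cells: in a cell $c=\{v,c_2,\dots,c_n\}$, the vertex $v$ is unblocked if $v\ne\ast$ and $\{e_v,c_2,\dots,c_n\}$ is a cell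 of $UD^n(\Gamma)$; otherwise $v$ is blocked. An edge $e$ of a cell $c$ is order-disrespecting in $c$ if some vertex $v$ of $c$ satisfies $\iota(e_v)=\iota(e)$ and $\iota(e)<v<\tau(e)$. A cell is critical if every vertex in it is blocked and every edge in it is order-disrespecting. Equivalence classes: $c\sim c'$ if $c$ and $c'$ have the same set $E$ of edges and each connected component of $\Gamma-E$ ($\Gamma$ minus the union of the closed edges in $E$) contains the same number of vertices of $c$ as of $c'$. $[c]$ is the equivalence class of $c$. Write $[d]\le[c]$ if there are representatives $c\in[c]$, $d\in[d]$ such that $d$ is obtained from $c$ by replacing some (possibly zero) edges of $c$ each with one of its endpoints. It is known (Farley–Sabalka) that $\le$ is a well-defined partial order, and that for every $k$-cell $c$ there is a unique collection $\{[c_1],\dots,[c_k]\}$ of equivalence classes of 1-cells having $[c]$ as its least upper bound. Arcs: an arc in $\Gamma$ is a subspace homeomorphic to a non-trivial closed interval; its endpoints need not be vertices. An oriented arc is an arc with a choice of orientation. Allowability: let $v$ be a vertex of degree $d$, with $e_j$ the edge incident to $v$ in direction $j$, $0\le j\le d-1$ (the notion below does not depend on the numbering of the incident edges). Given oriented arcs $\{A_i\}_{i=1}^k$, set $\eta_{j,i}(v)=1$ if $v\in A_i$, $A_i$ intersects the interior of $e_j$, and $A_i$ is oriented towards $v$ on $e_j$; set $\eta_{j,i}(v)=-1$ if $v\in A_i$, $A_i$ intersects the interior of $e_j$, and $A_i$ is oriented away from $v$ on $e_j$; set $\eta_{j,i}(v)=0$ if $v\notin A_i$ or $A_i$ does not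 intersect the interior of $e_j$. Let $\eta_j(v)=\sum_{i=1}^k\eta_{j,i}(v)$. The collection $\{A_i\}_{i=1}^k$ is allowable for a collection $\mathcal{V}$ of vertices if every $v\in\mathcal{V}$, of degree $d$ say, is not an endpoint of any $A_i$, and at least one of $\eta_0(v),\dots,\eta_{d-1}(v)$ is non-zero. (If $\mathcal{V}=\emptyset$, any collection of arcs is allowable for $\mathcal V$.) *)

theory Defs
  imports "HOL-Analysis.Analysis"
begin

section \<open>Graphs and trees\<close>

text \<open>
  A graph is a finite CW complex of dimension at most 1, living in a Hausdorff space. It is given
  by its set of vertices and the set of its closed edges, each closed edge being a set of points.
  For a finite complex in a Hausdorff space the weak topology is the subspace topology, so it is
  enough to ask for a characteristic map of each edge: a path that is injective except that its
  two ends may coincide (a loop), and that meets the vertices exactly in its ends.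
\<close>

record 'a cw_graph =
  verts :: "'a set"
  edges :: "'a set set"

definition points :: "'a cw_graph \<Rightarrow> 'a set" where
  "points G = verts G \<union> \<Union>(edges G)"

definition is_graph :: "'a::t2_space cw_graph \<Rightarrow> bool" where
  "is_graph G \<longleftrightarrow> finite (verts G) \<and> finite (edges G) \<and>
     (\<forall>e\<in>edges G. \<exists>\<phi>. simple_path \<phi> \<and> path_image \<phi> = e \<and>
        e \<inter> verts G = {pathstart \<phi>, pathfinish \<phi>}) \<and>
     (\<forall>e\<in>edges G. \<forall>f\<in>edges G. e \<noteq> f \<longrightarrow> e \<inter> f \<subseteq> verts G)"

definition is_tree :: "'a::t2_space cw_graph \<Rightarrow> bool" where
  "is_tree G \<longleftrightarrow> is_graph G \<and> connected (points G) \<and>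
     \<not> (\<exists>S\<subseteq>points G. S homeomorphic sphere (0::complex) 1)"

definition deg :: "'a cw_graph \<Rightarrow> 'a \<Rightarrow> nat" where
  "deg G v = card {e \<in> edges G. v \<in> e}"

definition essential :: "'a cw_graph \<Rightarrow> 'a set" where
  "essential G = {v \<in> verts G. 3 \<le> deg G v}"

definition verts_deg3 :: "'a cw_graph \<Rightarrow> 'a set" where
  "verts_deg3 G = {v \<in> verts G. deg G v = 3}"

definition verts_deg_gt3 :: "'a cw_graph \<Rightarrow> 'a set" where
  "verts_deg_gt3 G = {v \<in> verts G. 3 < deg G v}"

text \<open>
  An oriented arc in \<open>G\<close> is represented by an injective parametrization over the unit interval
  whose direction is the orientation; an unoriented arc is the image of such a path. The endpoints
  need not be vertices.
\<close>

definition arc_in :: "'a::t2_space cw_graph \<Rightarrow> (real \<Rightarrow> 'a) \<Rightarrow> bool" where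
  "arc_in G \<gamma> \<longleftrightarrow> arc \<gamma> \<and> path_image \<gamma> \<subseteq> points G"

definition arc_ends :: "(real \<Rightarrow> 'a::t2_space) \<Rightarrow> 'a set" where
  "arc_ends \<gamma> = {pathstart \<gamma>, pathfinish \<gamma>}"

definition arc_interior :: "(real \<Rightarrow> 'a::t2_space) \<Rightarrow> 'a set" where
  "arc_interior \<gamma> = path_image \<gamma> - arc_ends \<gamma>"

definition sufficiently_subdivided :: "'a::t2_space cw_graph \<Rightarrow> nat \<Rightarrow> bool" where
  "sufficiently_subdivided G n \<longleftrightarrow> n \<le> card (verts G) \<and>
     (\<forall>u\<in>verts G. \<forall>w\<in>verts G. u \<noteq> w \<longrightarrow> deg G u \<noteq> 2 \<longrightarrow> deg G w \<noteq> 2 \<longrightarrow>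
        (\<forall>\<gamma>. arc_in G \<gamma> \<longrightarrow> pathstart \<gamma> = u \<longrightarrow> pathfinish \<gamma> = w \<longrightarrow>
           n - 1 \<le> card {e \<in> edges G. e \<subseteq> path_image \<gamma>}))"


section \<open>Planar embeddings and the depth-first vertex numbering\<close>

text \<open>\<open>points G\<close> is compact, so a continuous injection into the plane is an embedding.\<close>

definition planar_embedding :: "'a::t2_space cw_graph \<Rightarrow> ('a \<Rightarrow> complex) \<Rightarrow> bool" where
  "planar_embedding G h \<longleftrightarrow> continuous_on (points G) h \<and> inj_on h (points G)"

text \<open>
  \<open>first_crossing h v e \<rho> p\<close>: travelling from \<open>v\<close> along \<open>e\<close>, the point \<open>p\<close> is the first one whose
  image lies on the circle of radius \<open>\<rho>\<close> around \<open>h v\<close>. Embedded edges are arbitrary (not necessarily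
  rectifiable or straight) arcs; the clockwise order of the edges around \<open>v\<close> is read off from the
  first crossings with small circles.
\<close>

definition first_crossing ::
  "('a::t2_space \<Rightarrow> complex) \<Rightarrow> 'a \<Rightarrow> 'a set \<Rightarrow> real \<Rightarrow> 'a \<Rightarrow> bool" where
  "first_crossing h v e \<rho> p \<longleftrightarrow>
     (\<exists>\<gamma>. arc \<gamma> \<and> pathstart \<gamma> = v \<and> pathfinish \<gamma> = p \<and> path_image \<gamma> \<subseteq> e \<and>
        dist (h v) (h p) = \<rho> \<and> (\<forall>x\<in>path_image \<gamma> - {p}. dist (h v) (h x) < \<rho>))"

text \<open>The clockwise angle, in \<open>[0, 2\<pi>)\<close>, from the direction \<open>a\<close> to the direction \<open>b\<close>.\<close>

definition cw_angle :: "complex \<Rightarrow> complex \<Rightarrow> real" where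
  "cw_angle a b = Arg2pi (a / b)"

text \<open>\<open>e\<close> is met before \<open>f\<close> when turning clockwise around \<open>v\<close> starting from \<open>e0\<close>.\<close>

definition clockwise_from ::
  "('a::t2_space \<Rightarrow> complex) \<Rightarrow> 'a \<Rightarrow> 'a set \<Rightarrow> 'a set \<Rightarrow> 'a set \<Rightarrow> bool" where
  "clockwise_from h v e0 e f \<longleftrightarrow>
     (\<forall>\<^sub>F \<rho> in at_right 0. \<forall>p0 p q.
        first_crossing h v e0 \<rho> p0 \<longrightarrow> first_crossing h v e \<rho> p \<longrightarrow> first_crossing h v f \<rho> q \<longrightarrow>
        cw_angle (h p0 - h v) (h p - h v) < cw_angle (h p0 - h v) (h q - h v))"

definition towards_root :: "'a::t2_space cw_graph \<Rightarrow> 'a \<Rightarrow> 'a \<Rightarrow> 'a set \<Rightarrow> bool" where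
  "towards_root G rt v e \<longleftrightarrow> e \<in> edges G \<and> v \<in> e \<and>
     (\<exists>\<gamma>. arc_in G \<gamma> \<and> pathstart \<gamma> = v \<and> pathfinish \<gamma> = rt \<and> e \<subseteq> path_image \<gamma>)"

text \<open>
  Among the edges leading away from the root, \<open>e\<close> has a smaller direction at \<open>v\<close> than \<open>f\<close>, where
  directions are numbered clockwise with 0 the edge towards the root. (At the root itself, which
  has degree 1, there is nothing to compare.)
\<close>

definition direction_less ::
  "'a::t2_space cw_graph \<Rightarrow> ('a \<Rightarrow> complex) \<Rightarrow> 'a \<Rightarrow> 'a \<Rightarrow> 'a set \<Rightarrow> 'a set \<Rightarrow> bool" where
  "direction_less G h rt v e f \<longleftrightarrow>
     (\<forall>e0. towards_root G rt v e0 \<longrightarrow> clockwise_from h v e0 e f)"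

definition other_end :: "'a cw_graph \<Rightarrow> 'a set \<Rightarrow> 'a \<Rightarrow> 'a" where
  "other_end G e v = (THE w. e \<inter> verts G = {v, w})"

text \<open>
  \<open>dfs G h rt v ws\<close>: travelling from \<open>v\<close> away from the root, always taking the leftmost edge not
  yet used and turning around at vertices of degree 1, the vertices are first encountered in the
  order \<open>ws\<close>. Seen from the edge of arrival, the leftmost edge is the first one clockwise.
\<close>

inductive dfs ::
  "'a::t2_space cw_graph \<Rightarrow> ('a \<Rightarrow> complex) \<Rightarrow> 'a \<Rightarrow> 'a \<Rightarrow> 'a list \<Rightarrow> bool"
  for G h rt where
  "distinct es \<Longrightarrow>
   set es = {e \<in> edges G. v \<in> e \<and> \<not> towards_root G rt v e} \<Longrightarrow>
   sorted_wrt (direction_less G h rt v) es \<Longrightarrow>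
   length wss = length es \<Longrightarrow>
   (\<forall>i<length es. dfs G h rt (other_end G (es ! i) v) (wss ! i)) \<Longrightarrow>
   dfs G h rt v (v # concat wss)"

definition dfs_numbering ::
  "'a::t2_space cw_graph \<Rightarrow> ('a \<Rightarrow> complex) \<Rightarrow> 'a \<Rightarrow> ('a \<Rightarrow> nat) \<Rightarrow> bool" where
  "dfs_numbering G h rt num \<longleftrightarrow>
     (\<exists>ws. dfs G h rt rt ws \<and> map num ws = [0..<length ws])"

definition edge_iota :: "'a cw_graph \<Rightarrow> ('a \<Rightarrow> nat) \<Rightarrow> 'a set \<Rightarrow> 'a" where
  "edge_iota G num e = arg_min num (\<lambda>v. v \<in> e \<inter> verts G)"

definition edge_tau :: "'a cw_graph \<Rightarrow> ('a \<Rightarrow> nat) \<Rightarrow> 'a set \<Rightarrow> 'a" where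
  "edge_tau G num e = arg_max num (\<lambda>v. v \<in> e \<inter> verts G)"

definition edge_to :: "'a cw_graph \<Rightarrow> ('a \<Rightarrow> nat) \<Rightarrow> 'a \<Rightarrow> 'a set" where
  "edge_to G num v = (THE e. e \<in> edges G \<and> edge_tau G num e = v)"


section \<open>Cells of the unordered discrete configuration space\<close>

text \<open>The vertex \<open>v\<close>, as a cell, is the set \<open>{v}\<close>; so all cells are sets of points.\<close>

definition cells :: "'a cw_graph \<Rightarrow> 'a set set" where
  "cells G = (\<lambda>v. {v}) ` verts G \<union> edges G"

definition ud_cell :: "'a cw_graph \<Rightarrow> nat \<Rightarrow> 'a set set \<Rightarrow> bool" where
  "ud_cell G n c \<longleftrightarrow> c \<subseteq> cells G \<and> finite c \<and> card c = n \<and> pairwise disjnt c"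

definition cell_edges :: "'a cw_graph \<Rightarrow> 'a set set \<Rightarrow> 'a set set" where
  "cell_edges G c = c \<inter> edges G"

definition cell_verts :: "'a cw_graph \<Rightarrow> 'a set set \<Rightarrow> 'a set" where
  "cell_verts G c = {v \<in> verts G. {v} \<in> c}"

definition cell_dim :: "'a cw_graph \<Rightarrow> 'a set set \<Rightarrow> nat" where
  "cell_dim G c = card (cell_edges G c)"

definition unblocked ::
  "'a cw_graph \<Rightarrow> 'a \<Rightarrow> ('a \<Rightarrow> nat) \<Rightarrow> nat \<Rightarrow> 'a set set \<Rightarrow> 'a \<Rightarrow> bool" where
  "unblocked G rt num n c v \<longleftrightarrow>
     v \<noteq> rt \<and> ud_cell G n (insert (edge_to G num v) (c - {{v}}))"

definition order_disrespecting ::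
  "'a cw_graph \<Rightarrow> ('a \<Rightarrow> nat) \<Rightarrow> 'a set set \<Rightarrow> 'a set \<Rightarrow> bool" where
  "order_disrespecting G num c e \<longleftrightarrow>
     (\<exists>v\<in>cell_verts G c. edge_iota G num (edge_to G num v) = edge_iota G num e \<and>
        num (edge_iota G num e) < num v \<and> num v < num (edge_tau G num e))"

definition critical_cell ::
  "'a cw_graph \<Rightarrow> 'a \<Rightarrow> ('a \<Rightarrow> nat) \<Rightarrow> nat \<Rightarrow> nat \<Rightarrow> 'a set set \<Rightarrow> bool" where
  "critical_cell G rt num n k c \<longleftrightarrow> ud_cell G n c \<and> cell_dim G c = k \<and>
     (\<forall>v\<in>cell_verts G c. \<not> unblocked G rt num n c v) \<and>
     (\<forall>e\<in>cell_edges G c. order_disrespecting G num c e)"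


section \<open>Equivalence classes of cells and their partial order\<close>

definition cell_equiv :: "'a::t2_space cw_graph \<Rightarrow> 'a set set \<Rightarrow> 'a set set \<Rightarrow> bool" where
  "cell_equiv G c c' \<longleftrightarrow> cell_edges G c = cell_edges G c' \<and>
     (\<forall>K\<in>components (points G - \<Union>(cell_edges G c)).
        card (cell_verts G c \<inter> K) = card (cell_verts G c' \<inter> K))"

definition cell_class :: "'a::t2_space cw_graph \<Rightarrow> nat \<Rightarrow> 'a set set \<Rightarrow> 'a set set set" where
  "cell_class G n c = {c'. ud_cell G n c' \<and> cell_equiv G c c'}"

definition classes :: "'a::t2_space cw_graph \<Rightarrow> nat \<Rightarrow> 'a set set set set" where
  "classes G n = cell_class G n ` {c. ud_cell G n c}"

definition classes_dim :: "'a::t2_space cw_graph \<Rightarrow> nat \<Rightarrow> nat \<Rightarrow> 'a set set set set" where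
  "classes_dim G n k = cell_class G n ` {c. ud_cell G n c \<and> cell_dim G c = k}"

definition face_of_cell :: "'a cw_graph \<Rightarrow> 'a set set \<Rightarrow> 'a set set \<Rightarrow> bool" where
  "face_of_cell G d c \<longleftrightarrow>
     (\<exists>F g. F \<subseteq> cell_edges G c \<and> (\<forall>e\<in>F. g e \<in> e \<inter> verts G) \<and>
        d = (c - F) \<union> (\<lambda>e. {g e}) ` F)"

definition class_le :: "'a cw_graph \<Rightarrow> 'a set set set \<Rightarrow> 'a set set set \<Rightarrow> bool" where
  "class_le G D C \<longleftrightarrow> (\<exists>d\<in>D. \<exists>c\<in>C. face_of_cell G d c)"

definition is_class_lub ::
  "'a::t2_space cw_graph \<Rightarrow> nat \<Rightarrow> 'a set set set set \<Rightarrow> 'a set set set \<Rightarrow> bool" where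
  "is_class_lub G n S C \<longleftrightarrow> C \<in> classes G n \<and> (\<forall>D\<in>S. class_le G D C) \<and>
     (\<forall>C'\<in>classes G n. (\<forall>D\<in>S. class_le G D C') \<longrightarrow> class_le G C C')"

text \<open>
  \<open>one_cell_classes G n k c S\<close>: \<open>S\<close> is a collection of \<open>k\<close> equivalence classes of 1-cells whose
  least upper bound is the class of \<open>c\<close>. For a \<open>k\<close>-cell \<open>c\<close> there is exactly one such \<open>S\<close>.
\<close>

definition one_cell_classes ::
  "'a::t2_space cw_graph \<Rightarrow> nat \<Rightarrow> nat \<Rightarrow> 'a set set \<Rightarrow> 'a set set set set \<Rightarrow> bool" where
  "one_cell_classes G n k c S \<longleftrightarrow> S \<subseteq> classes_dim G n 1 \<and> finite S \<and> card S = k \<and>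
     is_class_lub G n S (cell_class G n c)"


section \<open>Allowable collections of oriented arcs\<close>

definition oriented_towards ::
  "'a::t2_space cw_graph \<Rightarrow> (real \<Rightarrow> 'a) \<Rightarrow> 'a set \<Rightarrow> 'a \<Rightarrow> bool" where
  "oriented_towards G \<gamma> e v \<longleftrightarrow>
     (\<exists>t\<in>{0..1}. \<gamma> t = v \<and> (\<forall>s\<in>{0..1}. \<gamma> s \<in> e - verts G \<longrightarrow> s < t))"

definition oriented_away ::
  "'a::t2_space cw_graph \<Rightarrow> (real \<Rightarrow> 'a) \<Rightarrow> 'a set \<Rightarrow> 'a \<Rightarrow> bool" where
  "oriented_away G \<gamma> e v \<longleftrightarrow>
     (\<exists>t\<in>{0..1}. \<gamma> t = v \<and> (\<forall>s\<in>{0..1}. \<gamma> s \<in> e - verts G \<longrightarrow> t < s))"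

text \<open>
  The edges at \<open>v\<close> are used directly as indices in place of their direction numbers. The interior
  of the edge \<open>e\<close> is \<open>e - verts G\<close>.
\<close>

definition eta :: "'a::t2_space cw_graph \<Rightarrow> 'a \<Rightarrow> 'a set \<Rightarrow> (real \<Rightarrow> 'a) \<Rightarrow> int" where
  "eta G v e \<gamma> =
     (if v \<in> path_image \<gamma> \<and> path_image \<gamma> \<inter> (e - verts G) \<noteq> {}
      then if oriented_towards G \<gamma> e v then 1
           else if oriented_away G \<gamma> e v then -1 else 0
      else 0)"

definition allowable ::
  "'a::t2_space cw_graph \<Rightarrow> nat \<Rightarrow> (nat \<Rightarrow> real \<Rightarrow> 'a) \<Rightarrow> 'a set \<Rightarrow> bool" where
  "allowable G k A \<V> \<longleftrightarrow>
     (\<forall>v\<in>\<V>. (\<forall>i\<in>{1..k}. v \<notin> arc_ends (A i)) \<and>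
        (\<exists>e\<in>edges G. v \<in> e \<and> (\<Sum>i=1..k. eta G v e (A i)) \<noteq> 0))"

definition min_allowable :: "'a::t2_space cw_graph \<Rightarrow> 'a set \<Rightarrow> nat" where
  "min_allowable G \<V> =
     (LEAST k. \<exists>A. (\<forall>i\<in>{1..k}. arc_in G (A i)) \<and> allowable G k A \<V>)"

definition disjoint_essential_ends ::
  "'a::t2_space cw_graph \<Rightarrow> nat \<Rightarrow> (nat \<Rightarrow> real \<Rightarrow> 'a) \<Rightarrow> bool" where
  "disjoint_essential_ends G k A \<longleftrightarrow>
     (\<forall>l\<in>{1..k}. arc_ends (A l) \<subseteq> essential G \<and> pathstart (A l) \<noteq> pathfinish (A l)) \<and>
     (\<forall>l\<in>{1..k}. \<forall>l'\<in>{1..k}. l \<noteq> l' \<longrightarrow> arc_ends (A l) \<inter> arc_ends (A l') = {})"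

definition high_non_ends ::
  "'a::t2_space cw_graph \<Rightarrow> nat \<Rightarrow> (nat \<Rightarrow> real \<Rightarrow> 'a) \<Rightarrow> 'a set" where
  "high_non_ends G k A = {v \<in> verts_deg_gt3 G. \<forall>l\<in>{1..k}. v \<notin> arc_ends (A l)}"

end

theory Submission
  imports Defs
begin

text \<open>
  Every edge \<open>e\<close> of a critical cell has an essential initial vertex and comes with its own
  order-disrespecting vertex next to it, so a cell with \<open>k\<close> edges consists of \<open>k\<close> such pairs and
  \<open>n - 2k\<close> extra vertices. The 1-cell classes below the class of a cell \<open>c\<close> are its faces: one for each
  edge \<open>e\<close>, given by \<open>e\<close> and the number of members of \<open>c\<close> in each component of the complement of
  \<open>e\<close>. At a vertex of degree 3 occupied by both cells the edge is the same, so disjointness of the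
  two collections means that these counts differ somewhere.

  The pairs at common vertices contribute equally to both counts. Arcs joining what only the first
  cell occupies to what only the second cell occupies (extra vertices in part (1), essential
  vertices in part (2)) therefore have as their total \<open>\<eta>\<close> in each direction exactly the difference
  of the counts, because in a tree \<open>\<eta>\<close> of an arc at an edge only depends on which sides of the edge
  its endpoints lie. For odd \<open>n\<close> the unmatched extra vertices can only disturb this at vertices
  inside the arc \<open>A\<^sub>0\<close> joining them.
\<close>

section \<open>Trees as topological spaces\<close>

text \<open>The class of a 1-cell with edge \<open>e\<close> records counts in the components of the
  complement of the closed edge \<open>e\<close>, whereas \<open>eta\<close> at a vertex
  \<open>v\<close> compares far sides of the edges at \<open>v\<close>. For components attached at
  \<open>v\<close> the two notions agree. At the other end of \<open>e\<close> they could disagree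
  if several branches left it. Sufficient subdivision prevents this: two essential vertices joined
  by one edge force \<open>n\<close> \<le> 2 and the presence of at least two essential vertices,
  which the numerical hypotheses of both parts exclude. So at most one component is attached there,
  and it differs from the far side of \<open>e\<close> only by points, such as that end itself, that
  are neither extra vertices nor initial vertices of either cell.

  All facts about trees rest on one consequence of the absence of circles: every edge is a bridge,
  so removing its interior leaves two closed connected sides. The \<open>eta\<close> of an arc is
  then a difference of two indicators of its ends, and sums over a family of arcs do not depend on
  how starting points are paired with finishing points.\<close>

definition adjacent_via :: "'a cw_graph \<Rightarrow> 'a set set \<Rightarrow> ('a \<times> 'a) set" where
  "adjacent_via G F = {(x, y). x \<in> verts G \<and> y \<in> verts G \<and> (\<exists>e\<in>F. x \<in> e \<and> y \<in> e)}"

definition far_side :: "'a::t2_space cw_graph \<Rightarrow> 'a \<Rightarrow> 'a set \<Rightarrow> 'a set" where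
  "far_side G a e = connected_component_set (points G - (e - verts G)) (other_end G e a)"

text \<open>The connected component of the punctured tree at \<open>a\<close> that contains the
  interior of \<open>e\<close>. It has the same vertices as \<open>far_side\<close>, which is
  closed; \<open>branch\<close> becomes closed on adding \<open>a\<close>.\<close>

definition branch :: "'a::t2_space cw_graph \<Rightarrow> 'a \<Rightarrow> 'a set \<Rightarrow> 'a set" where
  "branch G a e = (e - verts G) \<union> far_side G a e"

locale planar_tree =
  fixes G :: "'a::t2_space cw_graph" and h :: "'a \<Rightarrow> complex"
  assumes tree: "is_tree G" and embedding: "planar_embedding G h"
begin

section \<open>Edges as arcs with two distinct ends\<close>

lemma finite_verts [simp]: "finite (verts G)"
  using tree unfolding is_tree_def is_graph_def by (elim conjE)

lemma finite_edges [simp]: "finite (edges G)"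
  using tree unfolding is_tree_def is_graph_def by (elim conjE)

lemma connected_points: "connected (points G)"
  using tree unfolding is_tree_def by (elim conjE)

lemma verts_subset_points: "verts G \<subseteq> points G"
  and edge_subset_points: "e \<in> edges G \<Longrightarrow> e \<subseteq> points G"
  by (auto simp: points_def)

lemma vert_in_points [simp]: "v \<in> verts G \<Longrightarrow> v \<in> points G"
  by (simp add: points_def)

lemma edge_path: "\<forall>e\<in>edges G. \<exists>\<phi>. simple_path \<phi> \<and> path_image \<phi> = e \<and>
      e \<inter> verts G = {pathstart \<phi>, pathfinish \<phi>}"
  using tree unfolding is_tree_def is_graph_def by (elim conjE)

lemma edges_meet: "\<lbrakk>e \<in> edges G; f \<in> edges G; e \<noteq> f; x \<in> e; x \<in> f\<rbrakk> \<Longrightarrow> x \<in> verts G"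
  using tree unfolding is_tree_def is_graph_def by (elim conjE) blast

lemma no_circle:
  assumes "simple_path \<gamma>" "pathfinish \<gamma> = pathstart \<gamma>" "path_image \<gamma> \<subseteq> points G"
  shows False
proof -
  have "path_image \<gamma> homeomorphic sphere (0::complex) 1"
    by (rule homeomorphic_simple_path_image_circle[OF assms(1,2)]) simp
  moreover have "\<not> (\<exists>S\<subseteq>points G. S homeomorphic sphere (0::complex) 1)"
    using tree unfolding is_tree_def by (elim conjE)
  ultimately show False using assms(3) by metis
qed

text \<open>A closed edge whose two ends coincide would itself be a circle.\<close>

lemma edge_arc:
  assumes "e \<in> edges G"
  obtains \<phi> where "arc \<phi>" "path_image \<phi> = e" "e \<inter> verts G = {pathstart \<phi>, pathfinish \<phi>}"
    "pathstart \<phi> \<noteq> pathfinish \<phi>"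
proof -
  obtain \<phi> where \<phi>: "simple_path \<phi>" "path_image \<phi> = e" "e \<inter> verts G = {pathstart \<phi>, pathfinish \<phi>}"
    using edge_path assms by metis
  then have "pathfinish \<phi> \<noteq> pathstart \<phi>"
    using no_circle[of \<phi>] edge_subset_points[OF assms] by blast
  then show thesis
    using that \<phi> simple_path_imp_arc by metis
qed

lemma other_end:
  assumes "e \<in> edges G" "a \<in> e" "a \<in> verts G"
  shows "e \<inter> verts G = {a, other_end G e a}" "other_end G e a \<noteq> a"
    "other_end G e a \<in> verts G" "other_end G e a \<in> e"
proof -
  obtain \<phi> where \<phi>: "e \<inter> verts G = {pathstart \<phi>, pathfinish \<phi>}" "pathstart \<phi> \<noteq> pathfinish \<phi>"
    using edge_arc assms by metis
  moreover have "a \<in> {pathstart \<phi>, pathfinish \<phi>}" using \<phi>(1) assms by blast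
  ultimately obtain w where w: "e \<inter> verts G = {a, w}" "w \<noteq> a"
    by (metis insert_commute insert_iff singletonD)
  have "other_end G e a = w"
    unfolding other_end_def using w by (intro the_equality) (auto simp: doubleton_eq_iff)
  with w show "e \<inter> verts G = {a, other_end G e a}" "other_end G e a \<noteq> a"
    "other_end G e a \<in> verts G" "other_end G e a \<in> e"
    by auto
qed

lemma other_end_other_end:
  assumes "e \<in> edges G" "a \<in> e" "a \<in> verts G"
  shows "other_end G e (other_end G e a) = a"
  using other_end[OF assms] other_end[of e "other_end G e a"] assms
  by (metis doubleton_eq_iff)

lemma edge_parametrization:
  assumes "e \<in> edges G" "a \<in> e" "a \<in> verts G"
  obtains \<phi> where "arc \<phi>" "path_image \<phi> = e" "pathstart \<phi> = a" "pathfinish \<phi> = other_end G e a"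
proof -
  obtain \<phi> where \<phi>: "arc \<phi>" "path_image \<phi> = e" "e \<inter> verts G = {pathstart \<phi>, pathfinish \<phi>}"
    "pathstart \<phi> \<noteq> pathfinish \<phi>"
    using edge_arc assms by metis
  note oe = other_end[OF assms]
  have "pathstart \<phi> = a \<and> pathfinish \<phi> = other_end G e a \<or>
      pathfinish \<phi> = a \<and> pathstart \<phi> = other_end G e a"
    using \<phi> oe by (metis doubleton_eq_iff)
  then show thesis
  proof
    assume "pathstart \<phi> = a \<and> pathfinish \<phi> = other_end G e a"
    then show thesis using that \<phi> by blast
  next
    assume "pathfinish \<phi> = a \<and> pathstart \<phi> = other_end G e a"
    then show thesis using that[of "reversepath \<phi>"] \<phi> by (simp add: arc_reversepath)
  qed
qed

section \<open>Topology of edges, reachability and arcs between vertices\<close>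

lemma closed_edge: "e \<in> edges G \<Longrightarrow> closed e"
  and compact_edge: "e \<in> edges G \<Longrightarrow> compact e"
  and path_connected_edge: "e \<in> edges G \<Longrightarrow> path_connected e"
  by (metis edge_arc closed_arc_image,
      metis edge_arc compact_arc_image,
      metis edge_arc path_connected_path_image arc_imp_path)

lemma connected_edge: "e \<in> edges G \<Longrightarrow> connected e"
  by (simp add: path_connected_edge path_connected_imp_connected)

lemma edge_has_vert: "e \<in> edges G \<Longrightarrow> \<exists>a. a \<in> e \<and> a \<in> verts G"
  by (metis edge_arc Int_iff insertI1)

lemma closed_edge_union: "F \<subseteq> edges G \<Longrightarrow> closed (\<Union>F)"
  by (meson closed_Union closed_edge finite_edges finite_subset subsetD)

lemma closed_vert_set: "W \<subseteq> verts G \<Longrightarrow> closed W"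
  by (meson finite_imp_closed finite_subset finite_verts)

lemma compact_points: "compact (points G)"
  unfolding points_def
  by (intro compact_Un compact_Union) (auto intro: finite_imp_compact compact_edge)

text \<open>Otherwise the vertices reachable from \<open>a\<close> and the remaining ones, each set
  enlarged by the edges of \<open>F\<close> at its members, would be two disjoint closed sets
  covering \<open>T\<close> and both meeting it. Disjointness holds because distinct edges share
  only vertices.\<close>

lemma connected_imp_reachable:
  assumes F: "F \<subseteq> edges G" and a: "a \<in> verts G" and b: "b \<in> verts G"
    and conn: "connected T" "a \<in> T" "b \<in> T" "T \<subseteq> verts G \<union> \<Union>F"
  shows "(a, b) \<in> (adjacent_via G F)\<^sup>*"
proof (rule ccontr)
  assume nb: "(a, b) \<notin> (adjacent_via G F)\<^sup>*"
  define W where "W = {w \<in> verts G. (a, w) \<in> (adjacent_via G F)\<^sup>*}"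
  have W_closed: "y \<in> W" if "x \<in> W" "g \<in> F" "x \<in> g" "y \<in> g" "y \<in> verts G" for x y g
  proof -
    have "(x, y) \<in> adjacent_via G F"
      using that by (auto simp: adjacent_via_def W_def)
    then show ?thesis using that by (auto simp: W_def)
  qed
  define P where "P W' = W' \<union> \<Union>{g \<in> F. g \<inter> W' \<noteq> {}}" for W'
  have clo: "closed (P W')" if "W' \<subseteq> verts G" for W'
    unfolding P_def using F that by (intro closed_Un closed_vert_set closed_edge_union) auto
  have W: "W \<subseteq> verts G" by (auto simp: W_def)
  have cov: "T \<subseteq> P W \<union> P (verts G - W)"
  proof
    fix x assume "x \<in> T"
    then consider "x \<in> verts G" | g where "g \<in> F" "x \<in> g" using conn by blast
    then show "x \<in> P W \<union> P (verts G - W)"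
    proof cases
      case 2
      then obtain w where "w \<in> g" "w \<in> verts G" using edge_has_vert F by blast
      then show ?thesis using 2 by (auto simp: P_def)
    qed (auto simp: P_def)
  qed
  have "P W \<inter> P (verts G - W) = {}"
  proof (rule ccontr)
    assume "P W \<inter> P (verts G - W) \<noteq> {}"
    then obtain x where x: "x \<in> P W" "x \<in> P (verts G - W)" by blast
    show False
    proof (cases "x \<in> verts G")
      case True
      have "x \<in> W"
        using x(1) True W_closed by (auto simp: P_def)
      with x(2) show False
        using True W_closed by (auto simp: P_def)
    next
      case False
      then obtain g g' where g: "g \<in> F" "x \<in> g" "g \<inter> W \<noteq> {}" "g' \<in> F" "x \<in> g'" "g' \<inter> (verts G - W) \<noteq> {}"
        using x W by (auto simp: P_def)
      then have "g = g'" using False edges_meet F by blast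
      then show False using g W_closed by blast
    qed
  qed
  then have "P W \<inter> T = {} \<or> P (verts G - W) \<inter> T = {}"
    using connected_closedD[OF conn(1) _ cov] clo[OF W] clo[of "verts G - W"] by blast
  moreover have "a \<in> P W" "b \<in> P (verts G - W)"
    using a b nb by (auto simp: P_def W_def)
  ultimately show False using conn by blast
qed

lemma reachable_imp_path_component:
  assumes F: "F \<subseteq> edges G" and a: "a \<in> verts G" and "(a, b) \<in> (adjacent_via G F)\<^sup>*"
  shows "path_component (verts G \<union> \<Union>F) a b"
  using assms(3)
proof induction
  case base
  then show ?case using a by (simp add: path_component_refl)
next
  case (step y z)
  then obtain e where e: "e \<in> F" "y \<in> e" "z \<in> e" by (auto simp: adjacent_via_def)
  then have "path_component e y z"
    using path_connected_edge F by (meson path_connected_component subsetD)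
  then have "path_component (verts G \<union> \<Union>F) y z"
    using e by (meson path_component_of_subset Sup_upper le_supI2)
  then show ?case using step.IH path_component_trans by blast
qed

text \<open>The path is carried by \<open>h\<close> to the plane, an arc is extracted from it there,
  and the arc is carried back by the inverse of \<open>h\<close>, which is continuous because
  \<open>points G\<close> is compact. The arc stays inside the image of the path and therefore
  inside \<open>S\<close>.\<close>

lemma path_component_imp_arc:
  assumes "S \<subseteq> points G" "path_component S a b" "a \<noteq> b"
  obtains \<gamma> where "arc \<gamma>" "path_image \<gamma> \<subseteq> S" "pathstart \<gamma> = a" "pathfinish \<gamma> = b"
proof -
  obtain k where k: "homeomorphism (points G) (h ` points G) h k"
    using embedding compact_points homeomorphism_compact[of "points G" h]
    by (auto simp: planar_embedding_def)
  obtain p where p: "path p" "path_image p \<subseteq> S" "pathstart p = a" "pathfinish p = b"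
    using assms(2) by (auto simp: path_component_def)
  have p': "path_image p \<subseteq> points G" using p assms by blast
  have ab: "a \<in> points G" "b \<in> points G"
    using p p' by (auto dest: subsetD[OF p'])
  have cont: "continuous_on (points G) h" "inj_on h (points G)"
    using embedding by (auto simp: planar_embedding_def)
  have "path (h \<circ> p)"
    using p(1) p' cont continuous_on_subset by (blast intro: path_continuous_image)
  moreover have "h a \<noteq> h b" using cont ab assms(3) by (auto dest: inj_onD)
  ultimately obtain q where q: "arc q" "path_image q \<subseteq> path_image (h \<circ> p)" "pathstart q = h a" "pathfinish q = h b"
    using path_contains_arc[of "h \<circ> p" "h a" "h b"] p by (auto simp: pathstart_compose pathfinish_compose)
  have sub: "path_image q \<subseteq> h ` path_image p" using q by (simp add: path_image_compose)
  have "arc (k \<circ> q)"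
  proof -
    have "path_image q \<subseteq> h ` points G" using sub p' by blast
    then have "continuous_on (path_image q) k" "inj_on k (path_image q)"
      using k by (auto simp: homeomorphism_def intro: continuous_on_subset inj_on_subset inj_on_inverseI)
    then show ?thesis
      using q(1) unfolding arc_def
      by (auto simp: path_image_def intro: path_continuous_image comp_inj_on)
  qed
  moreover have "path_image (k \<circ> q) \<subseteq> S"
  proof -
    have "k ` path_image q \<subseteq> k ` h ` path_image p" using sub by blast
    also have "k ` h ` path_image p = path_image p"
      using k p' by (force simp: homeomorphism_def image_image)
    finally have "k ` path_image q \<subseteq> S" using p(2) by blast
    then show ?thesis by (simp add: path_image_compose)
  qed
  moreover have "pathstart (k \<circ> q) = a" "pathfinish (k \<circ> q) = b"
    using q k ab by (auto simp: pathstart_compose pathfinish_compose homeomorphism_def)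
  ultimately show thesis using that by blast
qed

lemma arc_between:
  assumes "a \<in> verts G" "b \<in> verts G" "a \<noteq> b"
  obtains \<gamma> where "arc_in G \<gamma>" "pathstart \<gamma> = a" "pathfinish \<gamma> = b"
proof -
  have "(a, b) \<in> (adjacent_via G (edges G))\<^sup>*"
    using connected_imp_reachable[of "edges G" a b "points G"] connected_points assms
    by (simp add: points_def)
  then have "path_component (points G) a b"
    using reachable_imp_path_component[of "edges G"] assms by (simp add: points_def)
  then show thesis
    using path_component_imp_arc[of "points G" a b] that assms(3)
    unfolding arc_in_def by blast
qed

lemma points_minus_edge_interior:
  assumes "e \<in> edges G"
  shows "points G - (e - verts G) = verts G \<union> \<Union>(edges G - {e})"
  using assms edges_meet by (auto simp: points_def)

text \<open>An arc joining the two ends outside the interior of \<open>e\<close> would close up with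
  \<open>e\<close> to a circle.\<close>

lemma edge_is_bridge:
  assumes e: "e \<in> edges G" "a \<in> e" "a \<in> verts G"
  shows "\<not> connected_component (points G - (e - verts G)) a (other_end G e a)"
proof
  let ?b = "other_end G e a"
  note oe = other_end[OF e]
  assume "connected_component (points G - (e - verts G)) a ?b"
  then obtain T where "connected T" "a \<in> T" "?b \<in> T" "T \<subseteq> verts G \<union> \<Union>(edges G - {e})"
    unfolding points_minus_edge_interior[OF e(1)] connected_component_def by blast
  then have "(a, ?b) \<in> (adjacent_via G (edges G - {e}))\<^sup>*"
    using connected_imp_reachable[of "edges G - {e}" a ?b] e oe by blast
  then have "path_component (points G - (e - verts G)) a ?b"
    using reachable_imp_path_component[of "edges G - {e}"] e
    by (auto simp: points_minus_edge_interior)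
  then obtain \<gamma> where \<gamma>: "arc \<gamma>" "path_image \<gamma> \<subseteq> points G - (e - verts G)" "pathstart \<gamma> = a" "pathfinish \<gamma> = ?b"
    using path_component_imp_arc[of "points G - (e - verts G)" a ?b] oe by (metis Diff_subset)
  obtain \<phi> where \<phi>: "arc \<phi>" "path_image \<phi> = e" "pathstart \<phi> = a" "pathfinish \<phi> = ?b"
    using edge_parametrization e by metis
  have meet: "path_image \<gamma> \<inter> e \<subseteq> {a, ?b}" using \<gamma>(2) oe(1) by blast
  have "simple_path (\<gamma> +++ reversepath \<phi>)"
    using \<gamma> \<phi> meet by (intro simple_path_join_loop) (auto simp: arc_reversepath)
  moreover have "path_image (\<gamma> +++ reversepath \<phi>) \<subseteq> points G"
    using path_image_join_subset[of \<gamma> "reversepath \<phi>"] \<gamma>(2) \<phi>(2) edge_subset_points[OF e(1)] by auto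
  ultimately show False
    using no_circle \<gamma> \<phi> by (metis pathfinish_join pathfinish_reversepath pathstart_join)
qed

end

section \<open>The two sides of an edge\<close>

text \<open>The collapse of the tree to a unit interval that contracts each side of \<open>e\<close>
  to a point: the side containing \<open>a\<close> to 0, the side beyond \<open>e\<close> to
  1.\<close>

definition edge_coordinate :: "'a::t2_space cw_graph \<Rightarrow> 'a \<Rightarrow> 'a set \<Rightarrow> ('a \<Rightarrow> real) \<Rightarrow> bool" where
  "edge_coordinate G a e r \<longleftrightarrow> continuous_on (points G) r \<and>
     (\<forall>x\<in>far_side G (other_end G e a) e. r x = 0) \<and> (\<forall>x\<in>far_side G a e. r x = 1) \<and>
     (\<forall>x\<in>e - verts G. 0 < r x \<and> r x < 1) \<and> inj_on r (e - verts G)"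

lemma edge_coordinateD:
  assumes "edge_coordinate G a e r"
  shows "continuous_on (points G) r"
    "x \<in> far_side G (other_end G e a) e \<Longrightarrow> r x = 0"
    "x \<in> far_side G a e \<Longrightarrow> r x = 1"
    "x \<in> e - verts G \<Longrightarrow> 0 < r x \<and> r x < 1"
    "inj_on r (e - verts G)"
  using assms unfolding edge_coordinate_def by blast+

context planar_tree
begin

lemma closed_minus_edge_interior:
  assumes "e \<in> edges G"
  shows "closed (points G - (e - verts G))"
  unfolding points_minus_edge_interior[OF assms]
  by (intro closed_Un closed_vert_set closed_edge_union) auto

lemma closed_far_side: "e \<in> edges G \<Longrightarrow> closed (far_side G a e)"
  unfolding far_side_def by (intro closed_connected_component closed_minus_edge_interior)

lemma connected_far_side: "connected (far_side G a e)"
  unfolding far_side_def by (rule connected_connected_component)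

lemma far_side_subset: "far_side G a e \<subseteq> points G - (e - verts G)"
  unfolding far_side_def by (rule connected_component_subset)

lemma other_end_in_far_side:
  assumes "e \<in> edges G" "a \<in> e" "a \<in> verts G"
  shows "other_end G e a \<in> far_side G a e" "a \<in> far_side G (other_end G e a) e"
  unfolding far_side_def other_end_other_end[OF assms]
  using other_end[OF assms] assms by (auto intro!: connected_component_refl simp: points_def)

lemma far_sides_disjoint:
  assumes "e \<in> edges G" "a \<in> e" "a \<in> verts G"
  shows "far_side G a e \<inter> far_side G (other_end G e a) e = {}"
  using edge_is_bridge[OF assms] unfolding far_side_def other_end_other_end[OF assms]
  by (metis Int_emptyI connected_component_sym connected_component_trans mem_Collect_eq)

text \<open>Along a walk of edges from \<open>a\<close>, every edge other than \<open>e\<close>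
  stays in one component of the remaining space, and every passage along \<open>e\<close> ends in
  \<open>a\<close> or in the other end; so each vertex is connected to one of these two.\<close>

lemma far_sides_cover:
  assumes e: "e \<in> edges G" "a \<in> e" "a \<in> verts G"
  shows "far_side G a e \<union> far_side G (other_end G e a) e = points G - (e - verts G)"
proof
  let ?b = "other_end G e a" and ?Y = "points G - (e - verts G)"
  note oe = other_end[OF e]
  show "far_side G a e \<union> far_side G ?b e \<subseteq> ?Y"
    using far_side_subset by blast
  have edge: "connected_component ?Y x y" if "g \<in> edges G" "g \<noteq> e" "x \<in> g" "y \<in> g" for g x y
    unfolding connected_component_def points_minus_edge_interior[OF e(1)]
    using that connected_edge by (intro exI[of _ g]) auto
  have vert: "connected_component ?Y a w \<or> connected_component ?Y ?b w" if "w \<in> verts G" for w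
  proof -
    have "(a, w) \<in> (adjacent_via G (edges G))\<^sup>*"
      using connected_imp_reachable[of "edges G" a w "points G"] connected_points e that
      by (simp add: points_def)
    then show ?thesis
    proof induction
      case base
      then show ?case using e by (auto intro!: connected_component_refl)
    next
      case (step y z)
      then obtain g where g: "g \<in> edges G" "y \<in> g" "z \<in> g" "z \<in> verts G"
        by (auto simp: adjacent_via_def)
      show ?case
      proof (cases "g = e")
        case True
        then have "z = a \<or> z = ?b" using g oe(1) by blast
        then show ?thesis using g(4) by (auto intro!: connected_component_refl)
      next
        case False
        then show ?thesis using step.IH edge[OF g(1) _ g(2,3)] connected_component_trans by blast
      qed
    qed
  qed
  show "?Y \<subseteq> far_side G a e \<union> far_side G ?b e"
  proof
    fix x assume x: "x \<in> ?Y"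
    have "connected_component ?Y a x \<or> connected_component ?Y ?b x"
    proof (cases "x \<in> verts G")
      case False
      with x obtain g where g: "g \<in> edges G" "g \<noteq> e" "x \<in> g" by (auto simp: points_def)
      then obtain w where w: "w \<in> g" "w \<in> verts G" using edge_has_vert by blast
      then show ?thesis using vert[OF w(2)] edge[OF g(1,2) w(1) g(3)] connected_component_trans by blast
    qed (use vert in blast)
    then show "x \<in> far_side G a e \<union> far_side G ?b e"
      unfolding far_side_def other_end_other_end[OF e] by blast
  qed
qed

lemma far_side_Int_edge:
  assumes "e \<in> edges G" "a \<in> e" "a \<in> verts G"
  shows "e \<inter> far_side G a e = {other_end G e a}"
proof -
  have "e \<inter> far_side G a e \<subseteq> e \<inter> verts G" using far_side_subset by blast
  moreover have "a \<notin> far_side G a e"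
    using other_end_in_far_side(2)[OF assms] far_sides_disjoint[OF assms] by blast
  ultimately show ?thesis
    using other_end(1,4)[OF assms] other_end_in_far_side(1)[OF assms] by auto
qed

lemma base_notin_far_side:
  assumes "e \<in> edges G" "a \<in> e" "a \<in> verts G"
  shows "a \<notin> far_side G a e"
  using far_side_Int_edge[OF assms] other_end(2)[OF assms] assms(2) by (metis IntI singletonD)

lemma vert_far_side_iff:
  assumes "e \<in> edges G" "a \<in> e" "a \<in> verts G" "w \<in> verts G"
  shows "w \<in> far_side G (other_end G e a) e \<longleftrightarrow> w \<notin> far_side G a e"
  using far_sides_cover[OF assms(1-3)] far_sides_disjoint[OF assms(1-3)] assms(4) vert_in_points
  by blast

lemma edge_interior:
  assumes "e \<in> edges G" "a \<in> e" "a \<in> verts G" "arc \<phi>" "path_image \<phi> = e" "pathstart \<phi> = a"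
    "pathfinish \<phi> = other_end G e a"
  shows "e - verts G = \<phi> ` {0<..<1}"
proof -
  have "e - verts G = path_image \<phi> - {pathstart \<phi>, pathfinish \<phi>}"
    unfolding assms(5-7) other_end(1)[OF assms(1-3), symmetric] by blast
  then show ?thesis
    using simple_path_endless arc_imp_simple_path assms(4) by metis
qed

lemma edge_interior_nonempty: "e \<in> edges G \<Longrightarrow> e - verts G \<noteq> {}"
  using edge_has_vert edge_parametrization edge_interior
  by (metis empty_iff greaterThanLessThan_empty_iff image_is_empty not_one_le_zero)

text \<open>The interior is dense in the edge, being the image of an open interval under a
  parametrization.\<close>

lemma edge_subset_closed:
  assumes "e \<in> edges G" "closed P" "e - verts G \<subseteq> P"
  shows "e \<subseteq> P"
proof -
  obtain a where a: "a \<in> e" "a \<in> verts G" using edge_has_vert assms by blast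
  obtain \<phi> where \<phi>: "arc \<phi>" "path_image \<phi> = e" "pathstart \<phi> = a" "pathfinish \<phi> = other_end G e a"
    using edge_parametrization assms a by metis
  have "\<phi> ` closure {0<..<1::real} \<subseteq> P"
    using \<phi> assms edge_interior[OF assms(1) a \<phi>]
    by (intro image_closure_subset) (auto dest!: arc_imp_path simp: path_def)
  then show ?thesis using \<phi>(2) by (simp add: path_image_def)
qed

text \<open>The inverse of a parametrization of \<open>e\<close> is pasted with the constants 1 and
  0 on the two sides. The three sets are closed and overlap only in the ends of \<open>e\<close>,
  where the values agree.\<close>

lemma ex_edge_coordinate:
  assumes e: "e \<in> edges G" "a \<in> e" "a \<in> verts G"
  shows "\<exists>r. edge_coordinate G a e r"
proof -
  let ?b = "other_end G e a"
  obtain \<phi> where \<phi>: "arc \<phi>" "path_image \<phi> = e" "pathstart \<phi> = a" "pathfinish \<phi> = ?b"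
    using edge_parametrization e by metis
  note int = edge_interior[OF e \<phi>]
  obtain \<psi> where \<psi>: "homeomorphism {0..1} e \<phi> \<psi>"
    using homeomorphism_arc[OF \<phi>(1)] \<phi>(2) by metis
  have \<phi>01: "\<phi> 0 = a" "\<phi> 1 = ?b" using \<phi> by (auto simp: pathstart_def pathfinish_def)
  have inv: "\<psi> (\<phi> t) = t" if "t \<in> {0..1}" for t using \<psi> that by (auto simp: homeomorphism_def)
  have \<psi>ab: "\<psi> a = 0" "\<psi> ?b = 1" using inv[of 0] inv[of 1] \<phi>01 by auto
  define r where "r x = (if x \<in> e then \<psi> x else if x \<in> far_side G a e then 1 else 0)" for x
  have r0: "r x = 0" if "x \<in> far_side G ?b e" for x
  proof (cases "x \<in> e")
    case True
    have "e \<inter> far_side G ?b e = {a}"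
      using far_side_Int_edge[of e ?b] other_end[OF e] e other_end_other_end[OF e] by simp
    then show ?thesis using True that \<psi>ab by (auto simp: r_def)
  qed (use far_sides_disjoint[OF e] that in \<open>auto simp: r_def\<close>)
  have r1: "r x = 1" if "x \<in> far_side G a e" for x
  proof (cases "x \<in> e")
    case True
    then have "x = ?b" using far_side_Int_edge[OF e] that by blast
    then show ?thesis using True \<psi>ab by (simp add: r_def)
  qed (use that in \<open>simp add: r_def\<close>)
  have decomp: "points G = e \<union> (far_side G a e \<union> far_side G ?b e)"
    using far_sides_cover[OF e] edge_subset_points[OF e(1)] by auto
  have "continuous_on (e \<union> (far_side G a e \<union> far_side G ?b e)) r"
  proof (intro continuous_on_closed_Un closed_Un closed_edge[OF e(1)] closed_far_side[OF e(1)])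
    have "continuous_on e \<psi>" using \<psi> by (simp add: homeomorphism_def)
    then show "continuous_on e r"
      by (rule continuous_on_eq) (simp add: r_def)
    show "continuous_on (far_side G a e) r"
      using r1 by (intro continuous_on_eq[OF continuous_on_const[of _ 1]]) auto
    show "continuous_on (far_side G ?b e) r"
      using r0 by (intro continuous_on_eq[OF continuous_on_const[of _ 0]]) auto
  qed
  then have "continuous_on (points G) r" by (simp add: decomp)
  moreover have "0 < r x \<and> r x < 1" if "x \<in> e - verts G" for x
    using that int inv by (auto simp: r_def)
  moreover have "inj_on r (e - verts G)"
  proof -
    have "inj_on \<psi> e" using \<psi> by (auto simp: homeomorphism_def intro: inj_on_inverseI)
    then show ?thesis by (auto simp: r_def inj_on_def)
  qed
  ultimately show ?thesis using r0 r1 unfolding edge_coordinate_def by blast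
qed

text \<open>All statements about how an arc meets an edge come from the intermediate value theorem
  for the edge coordinate along the arc.\<close>

lemma arc_crossing:
  assumes e: "e \<in> edges G" "a \<in> e" "a \<in> verts G"
    and path: "path \<gamma>" "path_image \<gamma> \<subseteq> points G"
    and st: "0 \<le> s" "s \<le> t" "t \<le> 1"
    and sides: "\<gamma> s \<in> far_side G a e \<and> \<gamma> t \<in> far_side G (other_end G e a) e \<or>
      \<gamma> s \<in> far_side G (other_end G e a) e \<and> \<gamma> t \<in> far_side G a e"
    and x: "x \<in> e - verts G"
  shows "\<exists>u\<in>{s..t}. \<gamma> u = x"
proof -
  obtain r where "edge_coordinate G a e r" using ex_edge_coordinate[OF e] by blast
  note r = edge_coordinateD[OF this]
  have "continuous_on {0..1} (r \<circ> \<gamma>)"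
    using path by (intro continuous_on_compose continuous_on_subset[OF r(1)])
      (auto simp: path_def path_image_def)
  then have cont: "continuous_on {s..t} (r \<circ> \<gamma>)"
    using st by (auto intro: continuous_on_subset)
  have "\<exists>u\<ge>s. u \<le> t \<and> (r \<circ> \<gamma>) u = r x"
    using sides
  proof
    assume "\<gamma> s \<in> far_side G a e \<and> \<gamma> t \<in> far_side G (other_end G e a) e"
    then show ?thesis using r(2-4) x st(2) cont by (intro IVT2') (auto simp: less_imp_le)
  next
    assume "\<gamma> s \<in> far_side G (other_end G e a) e \<and> \<gamma> t \<in> far_side G a e"
    then show ?thesis using r(2-4) x st(2) cont by (intro IVT') (auto simp: less_imp_le)
  qed
  then obtain u where u: "s \<le> u" "u \<le> t" "r (\<gamma> u) = r x" by auto
  have "\<gamma> u \<in> points G" using path(2) u st by (auto simp: path_image_def)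
  moreover have "r (\<gamma> u) \<noteq> 0" "r (\<gamma> u) \<noteq> 1" using u(3) r(4)[OF x] by auto
  ultimately have "\<gamma> u \<in> e - verts G"
    using r(2,3) far_sides_cover[OF e] by blast
  then have "\<gamma> u = x" using r(5) u(3) x by (auto dest: inj_onD)
  then show ?thesis using u by auto
qed

lemma arc_covers_edge:
  assumes e: "e \<in> edges G" "a \<in> e" "a \<in> verts G"
    and \<gamma>: "path \<gamma>" "path_image \<gamma> \<subseteq> points G" "pathstart \<gamma> \<in> verts G" "pathfinish \<gamma> \<in> verts G"
    and sides: "pathstart \<gamma> \<in> far_side G a e \<longleftrightarrow> pathfinish \<gamma> \<notin> far_side G a e"
  shows "e \<subseteq> path_image \<gamma>"
proof (rule edge_subset_closed[OF e(1)])
  show "closed (path_image \<gamma>)" using \<gamma> by (simp add: closed_path_image)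
  show "e - verts G \<subseteq> path_image \<gamma>"
  proof
    fix x assume "x \<in> e - verts G"
    then have "\<exists>u\<in>{0..1}. \<gamma> u = x"
      using sides vert_far_side_iff[OF e \<gamma>(3)] vert_far_side_iff[OF e \<gamma>(4)]
      by (intro arc_crossing[OF e \<gamma>(1,2)]) (auto simp: pathstart_def pathfinish_def)
    then show "x \<in> path_image \<gamma>" by (auto simp: path_image_def)
  qed
qed

text \<open>If the arc entered the interior of \<open>e\<close>, its edge coordinate would leave the
  value 0 or 1 and return to it, taking some intermediate value both before and after. The
  coordinate being injective inside \<open>e\<close>, the arc would visit one point twice.\<close>

lemma arc_avoids_edge:
  assumes e: "e \<in> edges G" "a \<in> e" "a \<in> verts G"
    and \<gamma>: "arc_in G \<gamma>" "pathstart \<gamma> \<in> verts G" "pathfinish \<gamma> \<in> verts G"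
    and sides: "pathstart \<gamma> \<in> far_side G a e \<longleftrightarrow> pathfinish \<gamma> \<in> far_side G a e"
  shows "path_image \<gamma> \<inter> (e - verts G) = {}"
proof (rule ccontr)
  assume "path_image \<gamma> \<inter> (e - verts G) \<noteq> {}"
  then obtain s where "s \<in> {0..1}" and s: "\<gamma> s \<in> e - verts G"
    unfolding path_image_def by blast
  then have s: "0 \<le> s" "s \<le> 1" "\<gamma> s \<in> e - verts G" by auto
  obtain r where "edge_coordinate G a e r" using ex_edge_coordinate[OF e] by blast
  note r = edge_coordinateD[OF this]
  have arc: "path \<gamma>" "inj_on \<gamma> {0..1}" "path_image \<gamma> \<subseteq> points G"
    using \<gamma>(1) by (auto simp: arc_in_def arc_def)
  have "continuous_on {0..1} (r \<circ> \<gamma>)"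
    using arc by (intro continuous_on_compose continuous_on_subset[OF r(1)])
      (auto simp: path_def path_image_def)
  then have cont: "continuous_on {0..s} (r \<circ> \<gamma>)" "continuous_on {s..1} (r \<circ> \<gamma>)"
    using s by (auto intro: continuous_on_subset)
  have rs: "0 < r (\<gamma> s)" "r (\<gamma> s) < 1" using r(4)[OF s(3)] by auto
  have \<open>\<exists>z. z \<noteq> r (\<gamma> s) \<and> 0 < z \<and> z < 1 \<and> (\<exists>u\<ge>0. u \<le> s \<and> (r \<circ> \<gamma>) u = z) \<and> (\<exists>u\<ge>s. u \<le> 1 \<and> (r \<circ> \<gamma>) u = z)\<close>
  \<comment> \<open>The witness is the midpoint between the common value at both ends of the arc and
    the value at time \<open>s\<close>; as it differs from the latter, the two times at which it is
    taken are distinct.\<close>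
  proof (cases "pathstart \<gamma> \<in> far_side G a e")
    case True
    then have "r (\<gamma> 0) = 1" "r (\<gamma> 1) = 1" using sides r(3) by (auto simp: pathstart_def pathfinish_def)
    then show ?thesis using rs s cont
      by (intro exI[of _ "(1 + r (\<gamma> s)) / 2"] conjI IVT' IVT2') auto
  next
    case False
    then have "r (\<gamma> 0) = 0" "r (\<gamma> 1) = 0"
      using sides r(2) vert_far_side_iff[OF e \<gamma>(2)] vert_far_side_iff[OF e \<gamma>(3)]
      by (auto simp: pathstart_def pathfinish_def)
    then show ?thesis using rs s cont
      by (intro exI[of _ "r (\<gamma> s) / 2"] conjI IVT' IVT2') auto
  qed
  then obtain z u u' where z: "z \<noteq> r (\<gamma> s)" "0 < z" "z < 1"
    and u: "0 \<le> u" "u \<le> s" "r (\<gamma> u) = z" "s \<le> u'" "u' \<le> 1" "r (\<gamma> u') = z" by auto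
  have "\<gamma> w \<in> e - verts G" if "w \<in> {0..1}" "r (\<gamma> w) = z" for w
  proof -
    have "\<gamma> w \<in> points G" using that(1) arc(3) by (auto simp: path_image_def)
    moreover have "\<gamma> w \<notin> far_side G a e \<union> far_side G (other_end G e a) e"
      using r(2,3)[of "\<gamma> w"] that(2) z by auto
    ultimately show ?thesis unfolding far_sides_cover[OF e] by blast
  qed
  then have "\<gamma> u = \<gamma> u'" using u s r(5) by (auto dest!: inj_onD)
  then have "u = u'" using arc(2) u s by (auto dest: inj_onD)
  then show False using u z by auto
qed

text \<open>An arc with vertex ends on the same side of \<open>e\<close> misses the interior of
  \<open>e\<close>; otherwise it runs through all of \<open>e\<close> exactly once, in the direction
  determined by the side on which it starts. This makes \<open>eta\<close> depend on the two ends
  only.\<close>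

lemma eta_arc:
  assumes e: "e \<in> edges G" "v \<in> e" "v \<in> verts G"
    and \<gamma>: "arc_in G \<gamma>" "pathstart \<gamma> \<in> verts G" "pathfinish \<gamma> \<in> verts G"
  shows "eta G v e \<gamma> =
    of_bool (pathstart \<gamma> \<in> far_side G v e) - of_bool (pathfinish \<gamma> \<in> far_side G v e)"
proof (cases "pathstart \<gamma> \<in> far_side G v e \<longleftrightarrow> pathfinish \<gamma> \<in> far_side G v e")
  case True
  then show ?thesis using arc_avoids_edge[OF e \<gamma> True] by (auto simp: eta_def)
next
  case False
  have arc: "path \<gamma>" "inj_on \<gamma> {0..1}" "path_image \<gamma> \<subseteq> points G"
    using \<gamma>(1) by (auto simp: arc_in_def arc_def)
  have "e \<subseteq> path_image \<gamma>"
    using False by (intro arc_covers_edge[OF e arc(1,3) \<gamma>(2,3)]) auto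
  then have "v \<in> path_image \<gamma>" and meets: "path_image \<gamma> \<inter> (e - verts G) \<noteq> {}"
    using e edge_interior_nonempty[OF e(1)] by auto
  then obtain t where t: "t \<in> {0..1}" "\<gamma> t = v" unfolding path_image_def by blast
  obtain s where s: "s \<in> {0..1}" "\<gamma> s \<in> e - verts G"
    using meets unfolding path_image_def by blast
  have v: "v \<in> far_side G (other_end G e v) e" using other_end_in_far_side[OF e] by simp
  have neq: "s' \<noteq> t" if "\<gamma> s' \<in> e - verts G" for s' using t e that by auto
  show ?thesis
  proof (cases "pathstart \<gamma> \<in> far_side G v e")
    case True
    have "s' < t" if "s' \<in> {0..1}" "\<gamma> s' \<in> e - verts G" for s'
    proof (rule ccontr)
      assume "\<not> s' < t"
      \<comment> \<open>Before time \<open>t\<close> the arc already leads from beyond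
        \<open>e\<close> to \<open>v\<close>, hence through every interior point of
        \<open>e\<close>; the point at time \<open>s'\<close> would be visited again.\<close>
      have "\<exists>u\<in>{0..t}. \<gamma> u = \<gamma> s'"
        using True t v that(2) by (intro arc_crossing[OF e arc(1,3)]) (auto simp: pathstart_def)
      then show False using arc(2) t that \<open>\<not> s' < t\<close> neq[OF that(2)] by (auto dest!: inj_onD)
    qed
    then have "oriented_towards G \<gamma> e v" using t by (auto simp: oriented_towards_def)
    then show ?thesis using True False \<open>v \<in> path_image \<gamma>\<close> meets by (auto simp: eta_def)
  next
    case fin: False
    have away: "t < s'" if "s' \<in> {0..1}" "\<gamma> s' \<in> e - verts G" for s'
    proof (rule ccontr)
      assume "\<not> t < s'"
      have "\<exists>u\<in>{t..1}. \<gamma> u = \<gamma> s'"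
        using False fin t v that(2) by (intro arc_crossing[OF e arc(1,3)]) (auto simp: pathfinish_def)
      then show False using arc(2) t that \<open>\<not> t < s'\<close> neq[OF that(2)] by (auto dest!: inj_onD)
    qed
    then have "oriented_away G \<gamma> e v" using t by (auto simp: oriented_away_def)
    \<comment> \<open>\<open>eta\<close> tests \<open>oriented_towards\<close> first, so it has to
      be refuted. The time \<open>s\<close> inside the edge makes the two orientations incompatible;
      without such a time both would hold vacuously.\<close>
    moreover have "\<not> oriented_towards G \<gamma> e v"
    proof
      assume "oriented_towards G \<gamma> e v"
      then obtain t' where "t' \<in> {0..1}" "\<gamma> t' = v" "s < t'"
        using s by (auto simp: oriented_towards_def)
      then show False using away[OF s] t arc(2) by (metis inj_onD not_less_iff_gr_or_eq)
    qed
    ultimately show ?thesis using fin False \<open>v \<in> path_image \<gamma>\<close> meets by (auto simp: eta_def)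
  qed
qed

lemma towards_root_iff:
  assumes e: "e \<in> edges G" "v \<in> e" "v \<in> verts G" and rt: "rt \<in> verts G"
  shows "towards_root G rt v e \<longleftrightarrow> rt \<in> far_side G v e"
proof
  assume "towards_root G rt v e"
  then obtain \<gamma> where \<gamma>: "arc_in G \<gamma>" "pathstart \<gamma> = v" "pathfinish \<gamma> = rt" "e \<subseteq> path_image \<gamma>"
    by (auto simp: towards_root_def)
  show "rt \<in> far_side G v e"
  proof (rule ccontr)
    assume "rt \<notin> far_side G v e"
    then have "path_image \<gamma> \<inter> (e - verts G) = {}"
      using \<gamma> base_notin_far_side[OF e] e rt by (intro arc_avoids_edge[OF e]) auto
    then show False using \<gamma>(4) edge_interior_nonempty[OF e(1)] by blast
  qed
next
  assume rt_far: "rt \<in> far_side G v e"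
  then have "v \<noteq> rt" using base_notin_far_side[OF e] by blast
  then obtain \<gamma> where \<gamma>: "arc_in G \<gamma>" "pathstart \<gamma> = v" "pathfinish \<gamma> = rt"
    using arc_between e rt by metis
  then have "e \<subseteq> path_image \<gamma>"
    using e rt rt_far base_notin_far_side[OF e]
    by (intro arc_covers_edge[OF e]) (auto simp: arc_in_def arc_imp_path)
  then show "towards_root G rt v e" using \<gamma> e by (auto simp: towards_root_def)
qed

section \<open>Branches at a vertex and components of the complement of a closed edge\<close>

lemma branch_eq:
  assumes "e \<in> edges G" "a \<in> e" "a \<in> verts G"
  shows "branch G a e = (e - {a}) \<union> far_side G a e"
  using other_end[OF assms] other_end_in_far_side[OF assms] by (auto simp: branch_def)

lemma connected_branch:
  assumes e: "e \<in> edges G" "a \<in> e" "a \<in> verts G"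
  shows "connected (branch G a e)"
proof -
  obtain \<phi> where \<phi>: "arc \<phi>" "path_image \<phi> = e" "pathstart \<phi> = a" "pathfinish \<phi> = other_end G e a"
    using edge_parametrization e by metis
  have "e - {a} = \<phi> ` {0<..1}"
  proof -
    have "{0<..1} = {0..1} - {0::real}" by auto
    then have "\<phi> ` {0<..1} = \<phi> ` {0..1} - \<phi> ` {0}"
      using \<phi>(1) by (simp add: arc_def inj_on_image_set_diff[of _ "{0..1}"])
    then show ?thesis using \<phi> by (simp add: path_image_def pathstart_def)
  qed
  moreover have "continuous_on {0<..1} \<phi>"
    using \<phi>(1) by (auto simp: arc_def path_def intro: continuous_on_subset)
  then have "connected (\<phi> ` {0<..1})" by (intro connected_continuous_image) auto
  ultimately have "connected (e - {a})" by simp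
  moreover have "other_end G e a \<in> (e - {a}) \<inter> far_side G a e"
    using other_end[OF e] other_end_in_far_side[OF e] by simp
  ultimately show ?thesis
    unfolding branch_eq[OF e] using connected_far_side by (intro connected_Un) blast+
qed

lemma closed_insert_branch:
  assumes e: "e \<in> edges G" "a \<in> e" "a \<in> verts G"
  shows "closed (insert a (branch G a e))"
proof -
  have "insert a (branch G a e) = e \<union> far_side G a e"
    using e by (auto simp: branch_eq)
  then show ?thesis using closed_edge closed_far_side e by auto
qed

lemma points_minus_branch:
  assumes e: "e \<in> edges G" "a \<in> e" "a \<in> verts G"
  shows "points G - branch G a e = far_side G (other_end G e a) e"
  using far_sides_cover[OF e] far_sides_disjoint[OF e] far_side_subset[of "other_end G e a" e]
  unfolding branch_def by blast

lemma branch_subset_points: "e \<in> edges G \<Longrightarrow> branch G a e \<subseteq> points G"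
  using edge_subset_points far_side_subset[of a e] by (auto simp: branch_def)

lemma base_notin_branch:
  assumes "e \<in> edges G" "a \<in> e" "a \<in> verts G"
  shows "a \<notin> branch G a e"
  using base_notin_far_side[OF assms] assms by (simp add: branch_def)

lemma connected_subset_near_side:
  assumes e: "e \<in> edges G" "a \<in> e" "a \<in> verts G"
    and T: "connected T" "a \<in> T" "T \<subseteq> points G - (e - verts G)"
  shows "T \<inter> branch G a e = {}"
proof -
  have "T \<subseteq> far_side G (other_end G e a) e"
    using T unfolding far_side_def other_end_other_end[OF e] by (intro connected_component_maximal)
  then show ?thesis using points_minus_branch[OF e] by blast
qed

text \<open>The edge \<open>f\<close> together with everything beyond it is a connected set through
  \<open>a\<close> that avoids the interior of \<open>e\<close>, so it remains on the near side of
  \<open>e\<close>.\<close>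

lemma branches_disjoint:
  assumes e: "e \<in> edges G" "a \<in> e" "a \<in> verts G" and f: "f \<in> edges G" "a \<in> f" and "e \<noteq> f"
  shows "branch G a e \<inter> branch G a f = {}"
proof -
  have "e \<inter> (f - verts G) = {}" "f \<inter> (e - verts G) = {}"
    using edges_meet e f \<open>e \<noteq> f\<close> by blast+
  then have "f \<subseteq> points G - (e - verts G)" "e \<subseteq> points G - (f - verts G)"
    using edge_subset_points e f by blast+
  then have fe: "f \<inter> branch G a e = {}" "e \<inter> branch G a f = {}"
    using connected_subset_near_side e f connected_edge by blast+
  then have far: "e \<inter> far_side G a f = {}" by (auto simp: branch_def)
  have "connected (f \<union> far_side G a f)"
    using other_end_in_far_side[OF f e(3)] other_end[OF f e(3)]
    by (intro connected_Un connected_edge f connected_far_side) auto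
  moreover have "f \<union> far_side G a f \<subseteq> points G - (e - verts G)"
    using far fe(1) far_side_subset[of a f] edge_subset_points[OF f(1)] by (auto simp: branch_def)
  ultimately have "(f \<union> far_side G a f) \<inter> branch G a e = {}"
    using connected_subset_near_side[OF e] f by blast
  then show ?thesis by (auto simp: branch_def)
qed

text \<open>Connectedness of the tree: \<open>a\<close> and its branches form a closed set
  \<open>S\<close>, and the points in none of them form a closed set \<open>C\<close>, which must be
  empty as \<open>S\<close> is not.\<close>

lemma branches_cover:
  assumes a: "a \<in> verts G"
  shows "points G - {a} = (\<Union>e\<in>{e \<in> edges G. a \<in> e}. branch G a e)"
proof
  let ?E = "{e \<in> edges G. a \<in> e}"
  define S where "S = insert a (\<Union>e\<in>?E. insert a (branch G a e))"
  \<comment> \<open>The vertex \<open>a\<close> lies on the near side of every edge at it, so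
    intersecting near sides alone would leave \<open>a\<close> in \<open>C\<close>. The set
    \<open>Q\<close> omits \<open>a\<close> and is still closed.\<close>
  define Q where "Q = (verts G - {a}) \<union> \<Union>{e \<in> edges G. a \<notin> e}"
  define C where "C = (if ?E = {} then Q else Q \<inter> (\<Inter>e\<in>?E. far_side G (other_end G e a) e))"
  have cS: "closed S"
    unfolding S_def using a by (intro closed_insert closed_UN) (auto simp: closed_insert_branch)
  have cQ: "closed Q" unfolding Q_def
    by (intro closed_Un closed_vert_set closed_edge_union) auto
  then have cC: "closed C" unfolding C_def using a by (auto intro!: closed_Int closed_INT closed_far_side)
  have "a \<notin> Q" by (auto simp: Q_def)
  have "points G \<subseteq> S \<union> C"
  proof
    fix x assume x: "x \<in> points G"
    show "x \<in> S \<union> C"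
    proof (cases "x \<in> S")
      case False
      then have nb: "x \<notin> branch G a e" if "e \<in> ?E" for e
        using that False unfolding S_def by blast
      have "x \<noteq> a" using False by (auto simp: S_def)
      have "x \<in> Q"
      proof (rule ccontr)
        assume "x \<notin> Q"
        then obtain e where e: "e \<in> ?E" "x \<in> e"
          using x \<open>x \<noteq> a\<close> by (auto simp: Q_def points_def)
        then have "x \<in> branch G a e" using \<open>x \<noteq> a\<close> a by (auto simp: branch_eq)
        with nb e show False by blast
      qed
      moreover have "x \<in> far_side G (other_end G e a) e" if "e \<in> ?E" for e
        using nb[OF that] that x points_minus_branch[of e a] a by blast
      ultimately show ?thesis by (auto simp: C_def)
    qed auto
  qed
  moreover have "S \<inter> C = {}"
  proof -
    have "x \<notin> C" if "x \<in> branch G a e" "e \<in> ?E" for x e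
      using that points_minus_branch[of e a] a unfolding C_def by auto
    moreover have "a \<notin> C" using \<open>a \<notin> Q\<close> by (auto simp: C_def)
    ultimately show ?thesis by (auto simp: S_def)
  qed
  ultimately have "S \<inter> points G = {} \<or> C \<inter> points G = {}"
    using connected_closedD[OF connected_points _ _ cS cC] by blast
  moreover have "a \<in> S \<inter> points G" using a by (auto simp: S_def)
  ultimately have "points G \<subseteq> S" using \<open>points G \<subseteq> S \<union> C\<close> by blast
  then show "points G - {a} \<subseteq> (\<Union>e\<in>?E. branch G a e)" unfolding S_def by blast
  show "(\<Union>e\<in>?E. branch G a e) \<subseteq> points G - {a}"
    using branch_subset_points base_notin_branch a by blast
qed

lemma vert_in_branch_iff:
  "w \<in> verts G \<Longrightarrow> w \<in> branch G a e \<longleftrightarrow> w \<in> far_side G a e"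
  by (simp add: branch_def)

lemma verts_Int_branch: "verts G \<inter> branch G a e = verts G \<inter> far_side G a e"
  by (auto simp: branch_def)

lemma ex1_edge_with_far_side:
  assumes "a \<in> verts G" "w \<in> verts G" "w \<noteq> a"
  shows "\<exists>!e. e \<in> edges G \<and> a \<in> e \<and> w \<in> far_side G a e"
proof -
  have "w \<in> points G - {a}" using assms by auto
  then obtain e where e: "e \<in> edges G" "a \<in> e" "w \<in> branch G a e"
    unfolding branches_cover[OF assms(1)] by blast
  show ?thesis
  proof (intro ex1I[of _ e])
    show "e \<in> edges G \<and> a \<in> e \<and> w \<in> far_side G a e"
      using e assms vert_in_branch_iff by blast
    show "f = e" if "f \<in> edges G \<and> a \<in> f \<and> w \<in> far_side G a f" for f
      using that e branches_disjoint[of f a e] assms vert_in_branch_iff[of w a f] by blast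
  qed
qed

text \<open>A branch through another edge at an end \<open>a\<close> of \<open>e\<close> is
  connected, avoids \<open>e\<close> and becomes closed on adding \<open>a\<close>, as does its
  complement, which is the near side of that edge. Since \<open>a\<close> itself lies in
  \<open>e\<close>, the branch is open and closed in the complement of \<open>e\<close>.\<close>

lemma component_minus_edge:
  assumes e: "e \<in> edges G" and K: "K \<in> components (points G - e)"
  obtains a f where "a \<in> e" "a \<in> verts G" "f \<in> edges G" "a \<in> f" "f \<noteq> e" "K = branch G a f"
proof -
  obtain x where x: "x \<in> K" using K in_components_nonempty by blast
  have K_sub: "K \<subseteq> points G - e" using K in_components_subset by blast
  obtain c where c: "c \<in> e" "c \<in> verts G" using edge_has_vert e by blast
  note oe = other_end[OF e c]
  have "x \<in> far_side G c e \<or> x \<in> far_side G (other_end G e c) e"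
    using far_sides_cover[OF e c] x K_sub by blast
  then obtain a where a: "a \<in> e" "a \<in> verts G" "x \<in> far_side G (other_end G e a) e"
    using c oe other_end_other_end[OF e c] by metis
  have "x \<in> points G - {a}" using a x K_sub by blast
  then obtain f where f: "f \<in> edges G" "a \<in> f" "x \<in> branch G a f"
    unfolding branches_cover[OF a(2)] by blast
  have "f \<noteq> e" using f a points_minus_branch[OF e a(1,2)] by blast
  have ef: "e \<inter> branch G a f = {}"
  proof (rule connected_subset_near_side[OF f(1,2) a(2) connected_edge[OF e] a(1)])
    show "e \<subseteq> points G - (f - verts G)"
      using edges_meet e f \<open>f \<noteq> e\<close> edge_subset_points by blast
  qed
  have sub: "branch G a f \<subseteq> points G - e" using ef branch_subset_points f by blast
  have "branch G a f \<subseteq> K"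
    using components_maximal[OF K connected_branch[OF f(1,2) a(2)] sub] x f by blast
  moreover have "K \<subseteq> branch G a f"
  proof -
    have "K \<subseteq> insert a (branch G a f) \<union> far_side G (other_end G f a) f"
      using K_sub points_minus_branch[OF f(1,2) a(2)] by blast
    moreover have "insert a (branch G a f) \<inter> far_side G (other_end G f a) f \<inter> K = {}"
      using points_minus_branch[OF f(1,2) a(2)] K_sub a by blast
    ultimately have "insert a (branch G a f) \<inter> K = {} \<or> far_side G (other_end G f a) f \<inter> K = {}"
      using connected_closedD[OF in_components_connected[OF K]] closed_insert_branch[OF f(1,2) a(2)]
        closed_far_side[OF f(1)] by metis
    then show ?thesis
      using x f K_sub points_minus_branch[OF f(1,2) a(2)] by blast
  qed
  ultimately show thesis using that a f \<open>f \<noteq> e\<close> by blast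
qed

end

section \<open>Depth-first numbering and faces of cells\<close>

text \<open>Children and parents are told apart by the side of the edge on which the root lies.
  Closure under both, except for the parent of \<open>v\<close>, characterises the subtree at
  \<open>v\<close> without naming it. Quantifying over numberings inside the invariant allows it to
  be applied to a block of a longer list.\<close>

definition visits_subtree :: "'a::t2_space cw_graph \<Rightarrow> 'a \<Rightarrow> 'a \<Rightarrow> 'a list \<Rightarrow> bool" where
  "visits_subtree G rt v ws \<longleftrightarrow> ws \<noteq> [] \<and> hd ws = v \<and> set ws \<subseteq> verts G \<and>
    (\<forall>x\<in>set ws. \<forall>e\<in>edges G. x \<in> e \<longrightarrow> rt \<notin> far_side G x e \<longrightarrow> other_end G e x \<in> set ws) \<and>
    (\<forall>x\<in>set ws. \<forall>e\<in>edges G. x \<noteq> v \<longrightarrow> x \<in> e \<longrightarrow> rt \<in> far_side G x e \<longrightarrow> other_end G e x \<in> set ws) \<and>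
    (\<forall>num::'a \<Rightarrow> nat. sorted_wrt (<) (map num ws) \<longrightarrow>
       (\<forall>x\<in>set ws. \<forall>e\<in>edges G. x \<in> e \<longrightarrow> rt \<notin> far_side G x e \<longrightarrow> num x < num (other_end G e x)))"

lemma visits_subtreeD:
  assumes "visits_subtree G rt v ws"
  shows "ws \<noteq> []" "hd ws = v" "set ws \<subseteq> verts G"
    "\<lbrakk>x \<in> set ws; e \<in> edges G; x \<in> e; rt \<notin> far_side G x e\<rbrakk> \<Longrightarrow> other_end G e x \<in> set ws"
    "\<lbrakk>x \<in> set ws; e \<in> edges G; x \<noteq> v; x \<in> e; rt \<in> far_side G x e\<rbrakk> \<Longrightarrow> other_end G e x \<in> set ws"
    "\<lbrakk>sorted_wrt (<) (map (num::'a::t2_space \<Rightarrow> nat) ws); x \<in> set ws; e \<in> edges G; x \<in> e;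
      rt \<notin> far_side G x e\<rbrakk> \<Longrightarrow> num x < num (other_end G e x)"
  using assms unfolding visits_subtree_def by simp_all

context planar_tree
begin

lemma dfs_visits:
  assumes rt: "rt \<in> verts G"
  shows "dfs G h rt v ws \<Longrightarrow> v \<in> verts G \<Longrightarrow> visits_subtree G rt v ws"
proof (induction rule: dfs.induct)
  case (1 es v wss)
  have es: "e \<in> set es \<longleftrightarrow> e \<in> edges G \<and> v \<in> e \<and> rt \<notin> far_side G v e" for e
    using 1(2,6) towards_root_iff rt by auto
  define b where "b i = other_end G (es ! i) v" for i
  have esi: "es ! i \<in> edges G" "v \<in> es ! i" "rt \<notin> far_side G v (es ! i)" if "i < length es" for i
    using es[of "es ! i"] that nth_mem by auto
  have b: "b i \<in> verts G" "es ! i \<in> edges G" "b i \<in> es ! i" "rt \<in> far_side G (b i) (es ! i)"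
    "other_end G (es ! i) (b i) = v" if "i < length es" for i
    using other_end[OF esi(1,2)[OF that] 1(6)] other_end_other_end[OF esi(1,2)[OF that] 1(6)]
      vert_far_side_iff[OF esi(1,2)[OF that] 1(6) rt] esi[OF that]
    by (auto simp: b_def)
  have "visits_subtree G rt (b i) (wss ! i)" if "i < length es" for i
    using 1(5) b(1)[OF that] that unfolding b_def by simp
  note IH = visits_subtreeD[OF this]
  have in_concat: "x \<in> set (concat wss)" if "i < length es" "x \<in> set (wss ! i)" for i x
    using that 1(4) by (metis UN_I nth_mem set_concat)
  have concatE: "\<exists>i<length es. x \<in> set (wss ! i)" if "x \<in> set (concat wss)" for x
    using that 1(4) by (metis UN_E in_set_conv_nth set_concat)
  have b_in: "b i \<in> set (concat wss)" if "i < length es" for i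
    using in_concat[OF that] IH(1,2)[OF that] by (metis hd_in_set)
  have child: "other_end G e x \<in> set (concat wss)"
    if x: "x \<in> set (v # concat wss)" "e \<in> edges G" "x \<in> e" "rt \<notin> far_side G x e" for x e
  proof (cases "x \<in> set (concat wss)")
    case True
    then obtain i where "i < length es" "x \<in> set (wss ! i)" using concatE by blast
    then show ?thesis using IH(4) in_concat x by blast
  next
    case False
    then have "x = v" using x by simp
    then obtain i where "i < length es" "e = es ! i" using es[of e] x by (metis in_set_conv_nth)
    then show ?thesis using b_in \<open>x = v\<close> by (simp add: b_def)
  qed
  have parent: "other_end G e x \<in> set (v # concat wss)"
    if x: "x \<in> set (v # concat wss)" "x \<noteq> v" "e \<in> edges G" "x \<in> e" "rt \<in> far_side G x e" for x e
  proof -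
    obtain i where i: "i < length es" "x \<in> set (wss ! i)" using concatE x(1,2) by auto
    show ?thesis
    proof (cases "x = b i")
      case True
      have "rt \<noteq> x" using base_notin_far_side[of e x] x b(1)[OF i(1)] True by auto
      then have "e = es ! i"
        using ex1_edge_with_far_side[OF b(1)[OF i(1)] rt] b[OF i(1)] x True by blast
      then show ?thesis using b(5)[OF i(1)] True by simp
    next
      case False
      then show ?thesis using IH(5)[OF i(1,2) x(3) _ x(4,5)] in_concat[OF i(1)] by simp
    qed
  qed
  have less: "num x < num (other_end G e x)"
    if sorted: "sorted_wrt (<) (map num (v # concat wss))"
      and x: "x \<in> set (v # concat wss)" "e \<in> edges G" "x \<in> e" "rt \<notin> far_side G x e"
    for num :: "'a \<Rightarrow> nat" and x e
  proof (cases "x = v")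
    case True
    then show ?thesis using child[OF x] sorted by auto
  next
    case False
    then obtain i where i: "i < length es" "x \<in> set (wss ! i)" using concatE x(1) by auto
    \<comment> \<open>The visit of one child is a contiguous block of the whole list, so a numbering
      that increases along the list increases along the block.\<close>
    obtain us ws' where "wss = us @ wss ! i # ws'"
      using i 1(4) by (metis id_take_nth_drop)
    then have "concat wss = concat us @ wss ! i @ concat ws'"
      by (metis concat.simps(2) concat_append)
    then have "sorted_wrt (<) (map num (wss ! i))"
      using sorted by (simp add: sorted_wrt_append)
    then show ?thesis using IH(6)[OF i(1) _ i(2) x(2-4)] by blast
  qed
  have "set (v # concat wss) \<subseteq> verts G"
    using 1(6) IH(3) concatE by fastforce
  then show ?case using child parent less unfolding visits_subtree_def by auto
qed

section \<open>1-cell classes below the class of a cell\<close>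

lemma singleton_not_edge: "{v} \<notin> edges G"
proof
  assume v: "{v} \<in> edges G"
  then obtain a where "a \<in> {v}" "a \<in> verts G" using edge_has_vert by blast
  then show False using other_end(2,4)[OF v] by auto
qed

lemma cell_vert_notin_edge:
  assumes "ud_cell G n c" "v \<in> cell_verts G c" "e \<in> cell_edges G c"
  shows "v \<notin> e"
proof -
  have "{v} \<noteq> e" using assms singleton_not_edge by (auto simp: cell_edges_def)
  then have "disjnt {v} e"
    using assms pairwiseD[of disjnt c "{v}" e]
    by (simp add: ud_cell_def cell_verts_def cell_edges_def)
  then show ?thesis by simp
qed

lemma cell_edges_disjoint:
  assumes "ud_cell G n c" "e \<in> cell_edges G c" "f \<in> cell_edges G c" "e \<noteq> f"
  shows "e \<inter> f = {}"
  using assms pairwiseD[of disjnt c e f] by (simp add: ud_cell_def cell_edges_def disjnt_def)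

lemma cell_verts_subset: "cell_verts G c \<subseteq> verts G"
  and cell_edges_subset: "cell_edges G c \<subseteq> edges G"
  by (auto simp: cell_verts_def cell_edges_def)

lemma finite_cell_verts: "finite (cell_verts G c)"
  and finite_cell_edges: "finite (cell_edges G c)"
  using cell_verts_subset cell_edges_subset finite_verts finite_edges finite_subset by metis+

lemma cell_equiv_sym: "cell_equiv G c d \<Longrightarrow> cell_equiv G d c"
  by (simp add: cell_equiv_def)

lemma cell_equiv_trans: "cell_equiv G c d \<Longrightarrow> cell_equiv G d f \<Longrightarrow> cell_equiv G c f"
  by (simp add: cell_equiv_def)

lemma cell_class_eqI: "cell_equiv G c d \<Longrightarrow> cell_class G n c = cell_class G n d"
  unfolding cell_class_def using cell_equiv_sym cell_equiv_trans by blast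

text \<open>Equivalence compares counts in the components left after removing all edges of the cell.
  These refine the components left after removing \<open>e\<close> alone, so the coarser counts are
  sums of the finer ones.\<close>

lemma cell_equiv_card_component:
  assumes c: "ud_cell G n c" "ud_cell G n d" and equiv: "cell_equiv G c d"
    and e: "e \<in> cell_edges G c" and K: "K \<in> components (points G - e)"
  shows "card (cell_verts G c \<inter> K) = card (cell_verts G d \<inter> K)"
proof -
  define L where "L = points G - \<Union>(cell_edges G c)"
  have edges_eq: "cell_edges G d = cell_edges G c"
    and counts: "\<And>C. C \<in> components L \<Longrightarrow> card (cell_verts G c \<inter> C) = card (cell_verts G d \<inter> C)"
    using equiv by (auto simp: cell_equiv_def L_def)
  \<comment> \<open>Only fine components containing a vertex of \<open>K\<close> are collected: this
    keeps the family finite and loses no vertex of a cell.\<close>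
  define \<C> where "\<C> = connected_component_set L ` (verts G \<inter> L \<inter> K)"
  have comp: "C \<in> components L" "C \<subseteq> K" if C: "C \<in> \<C>" for C
  proof -
    obtain v where v: "v \<in> L" "v \<in> K" "C = connected_component_set L v"
      using C by (auto simp: \<C>_def)
    then show CL: "C \<in> components L" by (auto simp: components_def)
    have "C \<subseteq> points G - e"
      using in_components_subset[OF CL] e by (auto simp: L_def)
    moreover have "v \<in> C" using v by simp
    ultimately show "C \<subseteq> K"
      using components_maximal[OF K in_components_connected[OF CL]] v(2) by blast
  qed
  have sum: "card (A \<inter> K) = (\<Sum>C\<in>\<C>. card (A \<inter> C))" if A: "A \<subseteq> verts G" "A \<subseteq> L" for A
  proof -
    have "A \<inter> K = (\<Union>C\<in>\<C>. A \<inter> C)"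
      using A comp(2) unfolding \<C>_def by (auto intro!: connected_component_refl)
    also have "card \<dots> = (\<Sum>C\<in>\<C>. card (A \<inter> C))"
    proof (rule card_UN_disjoint)
      show "finite \<C>" by (simp add: \<C>_def)
      show "\<forall>C\<in>\<C>. finite (A \<inter> C)" using A(1) finite_subset[OF _ finite_verts] by blast
      show "\<forall>C\<in>\<C>. \<forall>C'\<in>\<C>. C \<noteq> C' \<longrightarrow> A \<inter> C \<inter> (A \<inter> C') = {}"
        using comp(1) components_nonoverlap by blast
    qed
    finally show ?thesis .
  qed
  have "cell_verts G c \<subseteq> L" "cell_verts G d \<subseteq> L"
    using cell_vert_notin_edge[OF c(1)] cell_vert_notin_edge[OF c(2)] edges_eq
      cell_verts_subset verts_subset_points unfolding L_def by blast+
  then show ?thesis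
    using sum cell_verts_subset counts comp(1) by simp
qed

text \<open>The number of vertices in \<open>K\<close> of a 1-cell obtained from \<open>c\<close> by
  replacing every edge other than \<open>e\<close> with one of its ends. The choice of the ends does
  not matter, because such an edge is connected and disjoint from \<open>e\<close>, hence inside a
  single component.\<close>

definition face_count :: "'a set set \<Rightarrow> 'a set \<Rightarrow> 'a set \<Rightarrow> nat" where
  "face_count c e K = card (cell_verts G c \<inter> K) + card {f \<in> cell_edges G c - {e}. f \<subseteq> K}"

text \<open>A face with a single edge keeps one edge of the representative and replaces all others.
  The representative need not be \<open>\<Phi>\<close> itself, but it has the same edges and, by
  \<open>cell_equiv_card_component\<close>, the same counts beside the edge kept.\<close>

lemma one_cell_class_below:
  assumes \<Phi>: "ud_cell G n \<Phi>" and D: "D \<in> classes_dim G n 1" "class_le G D (cell_class G n \<Phi>)"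
  obtains e d where "e \<in> cell_edges G \<Phi>" "D = cell_class G n d" "cell_edges G d = {e}"
    "\<And>K. K \<in> components (points G - e) \<Longrightarrow> card (cell_verts G d \<inter> K) = face_count \<Phi> e K"
proof -
  obtain d0 where d0: "ud_cell G n d0" "cell_dim G d0 = 1" "D = cell_class G n d0"
    using D(1) by (auto simp: classes_dim_def)
  obtain d c where d: "d \<in> D" and c: "c \<in> cell_class G n \<Phi>" and "face_of_cell G d c"
    using D(2) by (auto simp: class_le_def)
  then obtain F g where F: "F \<subseteq> cell_edges G c" and g: "\<And>f. f \<in> F \<Longrightarrow> g f \<in> f \<inter> verts G"
    and d_eq: "d = (c - F) \<union> (\<lambda>f. {g f}) ` F"
    by (auto simp: face_of_cell_def)
  have cd: "ud_cell G n c" "cell_equiv G \<Phi> c" and dd: "ud_cell G n d" "cell_equiv G d0 d"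
    using c d d0(3) by (auto simp: cell_class_def)
  have ec: "cell_edges G c = cell_edges G \<Phi>" using cd by (simp add: cell_equiv_def)
  have Dd: "D = cell_class G n d" using d0(3) cell_class_eqI[OF dd(2)] by simp
  have ed: "cell_edges G d = cell_edges G \<Phi> - F"
    using d_eq singleton_not_edge ec by (auto simp: cell_edges_def)
  have "card (cell_edges G d) = 1" using dd d0 by (simp add: cell_equiv_def cell_dim_def)
  then obtain e where e: "cell_edges G d = {e}" by (metis card_1_singletonE)
  then have e\<Phi>: "e \<in> cell_edges G \<Phi>" and F_eq: "F = cell_edges G \<Phi> - {e}"
    using ed F ec by auto
  have "F \<subseteq> edges G" using F cell_edges_subset by blast
  then have "{v} \<notin> F" for v using singleton_not_edge by blast
  then have vd: "cell_verts G d = cell_verts G c \<union> g ` F"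
    using d_eq g by (auto simp: cell_verts_def)
  have "card (cell_verts G d \<inter> K) = face_count \<Phi> e K" if K: "K \<in> components (points G - e)" for K
  proof -
    have gK: "g f \<in> K \<longleftrightarrow> f \<subseteq> K" if f: "f \<in> F" for f
    proof
      assume "g f \<in> K"
      have "e \<inter> f = {}" using f F_eq e\<Phi> cell_edges_disjoint[OF \<Phi>] by blast
      then have "f \<subseteq> points G - e" using f \<open>F \<subseteq> edges G\<close> edge_subset_points by blast
      then show "f \<subseteq> K"
        using components_maximal[OF K, of f] connected_edge f \<open>F \<subseteq> edges G\<close> \<open>g f \<in> K\<close> g[OF f] by blast
    qed (use g f in blast)
    have "inj_on g F"
      using g F_eq cell_edges_disjoint[OF \<Phi>] unfolding inj_on_def by (metis DiffD1 IntD1 IntI empty_iff)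
    have "cell_verts G d \<inter> K = (cell_verts G c \<inter> K) \<union> g ` {f \<in> F. f \<subseteq> K}"
      using vd gK by blast
    moreover have "cell_verts G c \<inter> g ` F = {}"
      using g F cell_vert_notin_edge[OF cd(1)] by blast
    ultimately have "card (cell_verts G d \<inter> K) = card (cell_verts G c \<inter> K) + card (g ` {f \<in> F. f \<subseteq> K})"
      using finite_cell_verts finite_subset[OF \<open>F \<subseteq> edges G\<close> finite_edges]
      by (auto intro!: card_Un_disjoint)
    also have "card (g ` {f \<in> F. f \<subseteq> K}) = card {f \<in> F. f \<subseteq> K}"
      using \<open>inj_on g F\<close> by (intro card_image) (auto intro: inj_on_subset)
    also have "card (cell_verts G c \<inter> K) = card (cell_verts G \<Phi> \<inter> K)"
      using cell_equiv_card_component[OF \<Phi> cd(1,2) e\<Phi> K] by simp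
    finally show ?thesis by (simp add: face_count_def F_eq)
  qed
  then show thesis using that e\<Phi> Dd e by blast
qed

text \<open>The edge kept determines the class, since it determines all counts. So the members of
  \<open>S\<close> keep distinct edges of \<open>\<Phi>\<close>, and as there are as many members as
  edges, every edge is kept by one of them.\<close>

lemma one_cell_classes_edge:
  assumes \<Phi>: "ud_cell G n \<Phi>" "cell_dim G \<Phi> = k" and S: "one_cell_classes G n k \<Phi> S"
    and e: "e \<in> cell_edges G \<Phi>"
  obtains d where "cell_class G n d \<in> S" "cell_edges G d = {e}"
    "\<And>K. K \<in> components (points G - e) \<Longrightarrow> card (cell_verts G d \<inter> K) = face_count \<Phi> e K"
proof -
  have S_le: "D \<in> classes_dim G n 1" "class_le G D (cell_class G n \<Phi>)" if "D \<in> S" for D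
    using S that by (auto simp: one_cell_classes_def is_class_lub_def)
  have S_card: "finite S" "card S = k"
    using S by (auto simp: one_cell_classes_def)
  define P where "P D e' d \<longleftrightarrow> e' \<in> cell_edges G \<Phi> \<and> D = cell_class G n d \<and> cell_edges G d = {e'} \<and>
    (\<forall>K\<in>components (points G - e'). card (cell_verts G d \<inter> K) = face_count \<Phi> e' K)" for D e' d
  have "\<exists>p. P D (fst p) (snd p)" if D: "D \<in> S" for D
  proof -
    have "\<exists>e' d. P D e' d"
      by (rule one_cell_class_below[OF \<Phi>(1) S_le[OF D]]) (unfold P_def, blast)
    then show ?thesis by simp
  qed
  then have "\<exists>p. \<forall>D\<in>S. P D (fst (p D)) (snd (p D))" by (intro bchoice) blast
  then obtain p where "\<forall>D\<in>S. P D (fst (p D)) (snd (p D))" by blast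
  then obtain \<epsilon> \<delta> where P: "\<And>D. D \<in> S \<Longrightarrow> P D (\<epsilon> D) (\<delta> D)"
    by (intro that[of "\<lambda>D. fst (p D)" "\<lambda>D. snd (p D)"]) simp
  have "inj_on \<epsilon> S"
  proof (rule inj_onI)
    fix D D' assume D: "D \<in> S" "D' \<in> S" "\<epsilon> D = \<epsilon> D'"
    then have "cell_equiv G (\<delta> D) (\<delta> D')"
      using P[OF D(1)] P[OF D(2)] by (simp add: P_def cell_equiv_def)
    then have "cell_class G n (\<delta> D) = cell_class G n (\<delta> D')" by (rule cell_class_eqI)
    then show "D = D'" using P[OF D(1)] P[OF D(2)] unfolding P_def by simp
  qed
  moreover have "\<epsilon> ` S \<subseteq> cell_edges G \<Phi>" using P by (auto simp: P_def)
  ultimately have "\<epsilon> ` S = cell_edges G \<Phi>"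
    using card_image[of \<epsilon> S] S_card(2) \<Phi>(2) unfolding cell_dim_def
    by (intro card_subset_eq finite_cell_edges) simp_all
  then have "e \<in> \<epsilon> ` S" using e by simp
  then obtain D where D: "D \<in> S" "\<epsilon> D = e" by (elim imageE) simp
  note PD = P[OF D(1), unfolded D(2) P_def]
  show thesis
  proof (rule that[of "\<delta> D"])
    show "cell_class G n (\<delta> D) \<in> S" using PD D(1) by metis
  qed (use PD in blast)+
qed

text \<open>Equal counts in all components would make the 1-cells of both collections at
  \<open>e\<close> equivalent, and their class would be a common member.\<close>

lemma disjoint_classes_face_count:
  assumes \<Phi>: "ud_cell G n \<Phi>" "cell_dim G \<Phi> = k" "one_cell_classes G n k \<Phi> S"
    and \<Psi>: "ud_cell G n \<Psi>" "cell_dim G \<Psi> = k" "one_cell_classes G n k \<Psi> T"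
    and "S \<inter> T = {}" and e: "e \<in> cell_edges G \<Phi>" "e \<in> cell_edges G \<Psi>"
  shows "\<exists>K\<in>components (points G - e). face_count \<Phi> e K \<noteq> face_count \<Psi> e K"
proof (rule ccontr)
  assume eq: "\<not> ?thesis"
  obtain d where d: "cell_class G n d \<in> S" "cell_edges G d = {e}"
    "\<And>K. K \<in> components (points G - e) \<Longrightarrow> card (cell_verts G d \<inter> K) = face_count \<Phi> e K"
    using one_cell_classes_edge[OF \<Phi> e(1)] by blast
  obtain d' where d': "cell_class G n d' \<in> T" "cell_edges G d' = {e}"
    "\<And>K. K \<in> components (points G - e) \<Longrightarrow> card (cell_verts G d' \<inter> K) = face_count \<Psi> e K"
    using one_cell_classes_edge[OF \<Psi> e(2)] by blast
  have "cell_equiv G d d'"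
    using d d' eq by (simp add: cell_equiv_def)
  then have "cell_class G n d = cell_class G n d'" by (rule cell_class_eqI)
  then show False using d(1) d'(1) \<open>S \<inter> T = {}\<close> by auto
qed

end

section \<open>Initial and terminal vertices of edges under the numbering\<close>

locale numbered_tree = planar_tree +
  fixes rt :: 'a and num :: "'a \<Rightarrow> nat"
  assumes root: "rt \<in> verts G" and deg_root: "deg G rt = 1"
    and numbering: "dfs_numbering G h rt num"
begin

text \<open>No edge at the root has the root beyond it, so the exception for the parent of the first
  vertex is void: the visited set is closed under adjacency and exhausts the connected tree.\<close>

lemma visited_all:
  obtains ws where "hd ws = rt" "set ws = verts G" "ws \<noteq> []" "sorted_wrt (<) (map num ws)"
    "\<And>x e. \<lbrakk>x \<in> verts G; e \<in> edges G; x \<in> e; rt \<notin> far_side G x e\<rbrakk> \<Longrightarrow> num x < num (other_end G e x)"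
proof -
  obtain ws where ws: "dfs G h rt rt ws" "map num ws = [0..<length ws]"
    using numbering by (auto simp: dfs_numbering_def)
  note visits = visits_subtreeD[OF dfs_visits[OF root ws(1) root]]
  have sorted: "sorted_wrt (<) (map num ws)" by (simp add: ws(2))
  have step: "y \<in> set ws" if x: "x \<in> set ws" and xy: "(x, y) \<in> adjacent_via G (edges G)" for x y
  proof -
    obtain e where e: "e \<in> edges G" "x \<in> e" "y \<in> e" "x \<in> verts G" "y \<in> verts G"
      using xy by (auto simp: adjacent_via_def)
    have "y = x \<or> y = other_end G e x" using other_end(1)[OF e(1,2,4)] e by blast
    moreover have "rt \<notin> far_side G x e" if "x = rt"
      using base_notin_far_side[OF e(1,2,4)] that by blast
    ultimately show ?thesis using visits(4,5)[OF x e(1)] x e(2) by metis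
  qed
  have "w \<in> set ws" if "w \<in> verts G" for w
  proof -
    have "(rt, w) \<in> (adjacent_via G (edges G))\<^sup>*"
      using connected_imp_reachable[of "edges G" rt w "points G"] connected_points root that
      by (simp add: points_def)
    then show ?thesis
    proof induction
      case base
      show ?case using visits(1,2) hd_in_set by metis
    qed (use step in blast)
  qed
  then have all: "set ws = verts G" using visits(3) by blast
  show thesis
  proof (rule that[of ws])
    show "num x < num (other_end G e x)"
      if "x \<in> verts G" "e \<in> edges G" "x \<in> e" "rt \<notin> far_side G x e" for x e
      using visits(6)[OF sorted] that all by simp
  qed (use visits(1,2) all sorted in auto)
qed

lemma num_less_other_end:
  "\<lbrakk>e \<in> edges G; x \<in> e; x \<in> verts G; rt \<notin> far_side G x e\<rbrakk> \<Longrightarrow> num x < num (other_end G e x)"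
  using visited_all by metis

lemma num_root_le:
  assumes v: "v \<in> verts G"
  shows "num rt \<le> num v"
proof -
  obtain ws where ws: "hd ws = rt" "set ws = verts G" "ws \<noteq> []" "sorted_wrt (<) (map num ws)"
    using visited_all by metis
  obtain us where "ws = rt # us" using ws(1,3) by (cases ws) auto
  moreover from this have "v \<in> set (rt # us)" using ws(2) v by simp
  ultimately show ?thesis using ws(4) by auto
qed

text \<open>Numbers increase away from the root, so the ends singled out by the numbering are the
  ends nearer to and farther from the root; from here on this geometric description can replace
  minima and maxima.\<close>

lemma edge_iota_tau:
  assumes e: "e \<in> edges G"
  shows "edge_iota G num e \<in> verts G" "edge_iota G num e \<in> e" "rt \<notin> far_side G (edge_iota G num e) e"
    "edge_tau G num e = other_end G e (edge_iota G num e)"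
    "edge_tau G num e \<in> verts G" "edge_tau G num e \<in> e" "rt \<in> far_side G (edge_tau G num e) e"
    "num (edge_iota G num e) < num (edge_tau G num e)"
proof -
  obtain c where c: "c \<in> e" "c \<in> verts G" using edge_has_vert e by blast
  obtain a where a: "a \<in> e" "a \<in> verts G" "rt \<notin> far_side G a e"
    using vert_far_side_iff[OF e c root] other_end[OF e c] c by blast
  define b where "b = other_end G e a"
  note oe = other_end[OF e a(1,2), folded b_def]
  have less: "num a < num b" using num_less_other_end[OF e a] by (simp add: b_def)
  have ends: "x \<in> e \<inter> verts G \<longleftrightarrow> x = a \<or> x = b" for x using oe(1) by blast
  have ia: "edge_iota G num e = a"
    unfolding edge_iota_def ends
    using arg_min_natI[of "\<lambda>x. x = a \<or> x = b" a num] arg_min_nat_le[of "\<lambda>x. x = a \<or> x = b" a num] less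
    by auto
  have tb: "edge_tau G num e = b"
    unfolding edge_tau_def ends
    \<comment> \<open>\<open>Suc (num b)\<close> bounds the numbers of both ends, which ensures that
      the maximum is attained.\<close>
    using arg_max_nat_lemma[of "\<lambda>x. x = a \<or> x = b" a num "Suc (num b)"]
      arg_max_nat_lemma[of "\<lambda>x. x = a \<or> x = b" b num "Suc (num b)"] less
    by auto
  show "edge_iota G num e \<in> verts G" "edge_iota G num e \<in> e" "rt \<notin> far_side G (edge_iota G num e) e"
    "edge_tau G num e = other_end G e (edge_iota G num e)"
    "edge_tau G num e \<in> verts G" "edge_tau G num e \<in> e" "rt \<in> far_side G (edge_tau G num e) e"
    "num (edge_iota G num e) < num (edge_tau G num e)"
    unfolding ia tb using a oe less b_def vert_far_side_iff[OF e a(1,2) root] by auto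
qed

lemma edge_ends:
  "e \<in> edges G \<Longrightarrow> e \<inter> verts G = {edge_iota G num e, edge_tau G num e}"
  using edge_iota_tau(1,2,4) other_end(1) by metis

lemma edge_tau_inj:
  assumes "e \<in> edges G" "f \<in> edges G" "edge_tau G num e = edge_tau G num f"
  shows "e = f"
proof -
  let ?t = "edge_tau G num e"
  note e = edge_iota_tau[OF assms(1)] and f = edge_iota_tau[OF assms(2), folded assms(3)]
  have "rt \<noteq> ?t" using base_notin_far_side[OF assms(1) e(6,5)] e(7) by metis
  then show ?thesis
    using ex1_edge_with_far_side[OF e(5) root] assms e(6,7) f(6,7) by blast
qed

lemma edge_to:
  assumes "v \<in> verts G" "v \<noteq> rt"
  shows "edge_to G num v \<in> edges G" "edge_tau G num (edge_to G num v) = v"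
proof -
  obtain e where e: "e \<in> edges G" "v \<in> e" "rt \<in> far_side G v e"
    using ex1_edge_with_far_side[OF assms(1) root] assms(2) by metis
  have "edge_tau G num e = v"
    using edge_ends[OF e(1)] edge_iota_tau(3)[OF e(1)] e(2,3) assms(1)
    by (metis IntI insert_iff singletonD)
  then have "\<exists>!e. e \<in> edges G \<and> edge_tau G num e = v"
    using e(1) edge_tau_inj by blast
  then show "edge_to G num v \<in> edges G" "edge_tau G num (edge_to G num v) = v"
    unfolding edge_to_def using theI' by (metis (mono_tags, lifting))+
qed

end

section \<open>Critical cells\<close>

text \<open>The common part contributes equally to both counts. Arcs can therefore join
  \<open>A - B\<close> to \<open>B - A\<close> while their totals express the full counts of
  \<open>A\<close> and \<open>B\<close>.\<close>

lemma int_card_Diff_cancel: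
  assumes "finite A" "finite B"
  shows "int (card ((A - B) \<inter> F)) - int (card ((B - A) \<inter> F)) = int (card (A \<inter> F)) - int (card (B \<inter> F))"
proof -
  have "A \<inter> F = ((A - B) \<inter> F) \<union> (A \<inter> B \<inter> F)" "B \<inter> F = ((B - A) \<inter> F) \<union> (A \<inter> B \<inter> F)" by auto
  moreover have "card (((A - B) \<inter> F) \<union> (A \<inter> B \<inter> F)) = card ((A - B) \<inter> F) + card (A \<inter> B \<inter> F)"
    "card (((B - A) \<inter> F) \<union> (A \<inter> B \<inter> F)) = card ((B - A) \<inter> F) + card (A \<inter> B \<inter> F)"
    using assms by (auto intro!: card_Un_disjoint)
  ultimately show ?thesis by simp
qed

definition disrespecters :: "'a cw_graph \<Rightarrow> ('a \<Rightarrow> nat) \<Rightarrow> 'a set set \<Rightarrow> 'a set \<Rightarrow> 'a set" where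
  "disrespecters G num c e = {v \<in> cell_verts G c.
     edge_iota G num (edge_to G num v) = edge_iota G num e \<and>
     num (edge_iota G num e) < num v \<and> num v < num (edge_tau G num e)}"

text \<open>An edge may have several disrespecting vertices; one is fixed so that it can be paired
  with the edge, and any others count as extra vertices.\<close>

definition disrespecter :: "'a cw_graph \<Rightarrow> ('a \<Rightarrow> nat) \<Rightarrow> 'a set set \<Rightarrow> 'a set \<Rightarrow> 'a" where
  "disrespecter G num c e = (SOME v. v \<in> disrespecters G num c e)"

definition iotas :: "'a cw_graph \<Rightarrow> ('a \<Rightarrow> nat) \<Rightarrow> 'a set set \<Rightarrow> 'a set" where
  "iotas G num c = edge_iota G num ` cell_edges G c"

definition extras :: "'a cw_graph \<Rightarrow> ('a \<Rightarrow> nat) \<Rightarrow> 'a set set \<Rightarrow> 'a set" where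
  "extras G num c = cell_verts G c - disrespecter G num c ` cell_edges G c"

definition disrespectful_cell :: "'a cw_graph \<Rightarrow> ('a \<Rightarrow> nat) \<Rightarrow> nat \<Rightarrow> nat \<Rightarrow> 'a set set \<Rightarrow> bool" where
  "disrespectful_cell G num n k c \<longleftrightarrow> ud_cell G n c \<and> cell_dim G c = k \<and>
     (\<forall>e\<in>cell_edges G c. order_disrespecting G num c e)"

lemma disrespectful_cellD:
  assumes "disrespectful_cell G num n k c"
  shows "ud_cell G n c" "cell_dim G c = k" "\<And>e. e \<in> cell_edges G c \<Longrightarrow> order_disrespecting G num c e"
  using assms by (auto simp: disrespectful_cell_def)

lemma critical_imp_disrespectful:
  "critical_cell G rt num n k c \<Longrightarrow> disrespectful_cell G num n k c"
  by (simp add: critical_cell_def disrespectful_cell_def)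

section \<open>Arcs matching two vertex sets, and adjacent essential vertices\<close>

context planar_tree
begin

lemma component_connected_iff:
  assumes "K \<in> components (points G - e)" "connected T" "T \<subseteq> points G - e" "x \<in> T" "y \<in> T"
  shows "x \<in> K \<longleftrightarrow> y \<in> K"
  using components_maximal[OF assms(1-3)] assms(4,5) by blast

text \<open>By \<open>eta_arc\<close> the sum separates into indicators of the starting points minus
  indicators of the finishing points, so any bijections with \<open>{1..k}\<close> serve.\<close>

lemma matching_arcs:
  assumes P: "P \<subseteq> verts G" and Q: "Q \<subseteq> verts G" and disj: "P \<inter> Q = {}"
    and k: "card P = k" "card Q = k"
  obtains A where "\<And>i. i \<in> {1..k} \<Longrightarrow> arc_in G (A i)"
    "bij_betw (\<lambda>i. pathstart (A i)) {1..k} P" "bij_betw (\<lambda>i. pathfinish (A i)) {1..k} Q"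
    "\<And>v f. \<lbrakk>v \<in> verts G; f \<in> edges G; v \<in> f\<rbrakk> \<Longrightarrow> (\<Sum>i=1..k. eta G v f (A i)) =
      int (card (P \<inter> far_side G v f)) - int (card (Q \<inter> far_side G v f))"
proof -
  have fin: "finite P" "finite Q" using P Q finite_subset finite_verts by blast+
  obtain p q where p: "bij_betw p {1..k} P" and q: "bij_betw q {1..k} Q"
    using ex_bij_betw_nat_finite_1 fin k by metis
  have pq: "p i \<in> P" "q i \<in> Q" if "i \<in> {1..k}" for i
    using bij_betw_apply[OF p that] bij_betw_apply[OF q that] by auto
  have "\<exists>\<gamma>. arc_in G \<gamma> \<and> pathstart \<gamma> = p i \<and> pathfinish \<gamma> = q i" if "i \<in> {1..k}" for i
  proof -
    have "p i \<in> verts G" "q i \<in> verts G" "p i \<noteq> q i" using pq[OF that] P Q disj by auto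
    then show ?thesis using arc_between by metis
  qed
  then obtain A where A: "\<And>i. i \<in> {1..k} \<Longrightarrow> arc_in G (A i) \<and> pathstart (A i) = p i \<and> pathfinish (A i) = q i"
    by metis
  show thesis
  proof (rule that[of A])
    show "arc_in G (A i)" if "i \<in> {1..k}" for i using A[OF that] by simp
    show "bij_betw (\<lambda>i. pathstart (A i)) {1..k} P"
      using p by (subst bij_betw_cong[where g = p]) (use A in auto)
    show "bij_betw (\<lambda>i. pathfinish (A i)) {1..k} Q"
      using q by (subst bij_betw_cong[where g = q]) (use A in auto)
    fix v f assume v: "v \<in> verts G" "f \<in> edges G" "v \<in> f"
    have cnt: "(\<Sum>i=1..k. of_bool (b i \<in> F) :: int) = int (card (B \<inter> F))"
      if b: "bij_betw b {1..k} B" "finite B" for b B F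
    proof -
      have "(\<Sum>i=1..k. of_bool (b i \<in> F) :: int) = (\<Sum>x\<in>B. of_bool (x \<in> F))"
        using sum.reindex_bij_betw[OF b(1)] .
      also have "\<dots> = int (card (B \<inter> F))"
        using b(2) by (simp add: Int_def)
      finally show ?thesis .
    qed
    have "(\<Sum>i=1..k. eta G v f (A i)) =
      (\<Sum>i=1..k. of_bool (p i \<in> far_side G v f) - of_bool (q i \<in> far_side G v f))"
    proof (rule sum.cong[OF refl])
      fix i assume i: "i \<in> {1..k}"
      show "eta G v f (A i) = of_bool (p i \<in> far_side G v f) - of_bool (q i \<in> far_side G v f)"
        using eta_arc[OF v(2,3,1), of "A i"] A[OF i] pq[OF i] P Q by (metis subsetD)
    qed
    then show "(\<Sum>i=1..k. eta G v f (A i)) =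
        int (card (P \<inter> far_side G v f)) - int (card (Q \<inter> far_side G v f))"
      using cnt[OF p fin(1)] cnt[OF q fin(2)] by (simp add: sum_subtractf)
  qed
qed

lemma card_cell:
  assumes "ud_cell G n c"
  shows "n = card (cell_edges G c) + card (cell_verts G c)"
proof -
  have "c = cell_edges G c \<union> (\<lambda>v. {v}) ` cell_verts G c"
    using assms by (auto simp: ud_cell_def cells_def cell_edges_def cell_verts_def)
  moreover have "cell_edges G c \<inter> (\<lambda>v. {v}) ` cell_verts G c = {}"
    using singleton_not_edge cell_edges_subset by blast
  moreover have "card ((\<lambda>v. {v}) ` cell_verts G c) = card (cell_verts G c)"
    by (intro card_image) (auto intro: inj_onI)
  ultimately have "card c = card (cell_edges G c) + card (cell_verts G c)"
    using card_Un_disjoint[of "cell_edges G c" "(\<lambda>v. {v}) ` cell_verts G c"]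
      finite_cell_edges finite_cell_verts by simp
  then show ?thesis using assms by (simp add: ud_cell_def)
qed

lemma essential_split: "essential G = verts_deg3 G \<union> verts_deg_gt3 G"
  and deg3_gt3_disjoint: "verts_deg3 G \<inter> verts_deg_gt3 G = {}"
  by (auto simp: essential_def verts_deg3_def verts_deg_gt3_def)

lemma finite_essential: "finite (essential G)"
  by (simp add: essential_def)

lemma edges_inside_edge:
  assumes "e \<in> edges G"
  shows "{f \<in> edges G. f \<subseteq> e} = {e}"
proof -
  have "f = e" if "f \<in> edges G" "f \<subseteq> e" for f
    using edges_meet[OF that(1) assms] edge_interior_nonempty[OF that(1)] that(2) by blast
  then show ?thesis using assms by blast
qed

text \<open>The edge itself is an arc between two vertices of degree other than 2 that contains
  exactly one edge, so subdivision yields \<open>n - 1\<close> \<le> 1.\<close>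

lemma adjacent_essential:
  assumes "sufficiently_subdivided G n" "e \<in> edges G" "a \<in> e" "a \<in> essential G"
    "other_end G e a \<in> essential G"
  shows "n \<le> 2" "card (essential G) \<ge> 2"
proof -
  have a: "a \<in> verts G" using assms(4) by (simp add: essential_def)
  note oe = other_end[OF assms(2,3) a]
  obtain \<phi> where \<phi>: "arc \<phi>" "path_image \<phi> = e" "pathstart \<phi> = a" "pathfinish \<phi> = other_end G e a"
    using edge_parametrization[OF assms(2,3) a] by metis
  have "arc_in G \<phi>" using \<phi> edge_subset_points[OF assms(2)] by (simp add: arc_in_def)
  moreover have "deg G a \<noteq> 2" "deg G (other_end G e a) \<noteq> 2"
    using assms(4,5) by (auto simp: essential_def)
  ultimately have "n - 1 \<le> card {f \<in> edges G. f \<subseteq> path_image \<phi>}"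
    using a oe(2,3) \<phi>(3,4)
    by (intro assms(1)[unfolded sufficiently_subdivided_def, THEN conjunct2, rule_format, of a "other_end G e a"])
      auto
  then show "n \<le> 2" using edges_inside_edge[OF assms(2)] \<phi>(2) by simp
  have "card {a, other_end G e a} \<le> card (essential G)"
    using assms finite_essential by (intro card_mono) auto
  then show "card (essential G) \<ge> 2" using oe(2) by auto
qed

end

context numbered_tree
begin

section \<open>Edges paired with their disrespecting vertices\<close>

lemma iotas_subset: "iotas G num c \<subseteq> verts G"
  using edge_iota_tau(1) cell_edges_subset by (auto simp: iotas_def)

lemma extras_subset: "extras G num c \<subseteq> verts G"
  using cell_verts_subset by (auto simp: extras_def)

lemma finite_iotas: "finite (iotas G num c)" and finite_extras: "finite (extras G num c)"
  using iotas_subset extras_subset finite_subset finite_verts by metis+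

lemma disrespectersD:
  assumes e: "e \<in> edges G" and u: "u \<in> disrespecters G num c e"
  shows "u \<in> cell_verts G c" "edge_to G num u \<in> edges G" "edge_to G num u \<noteq> e"
    "edge_iota G num (edge_to G num u) = edge_iota G num e" "edge_tau G num (edge_to G num u) = u"
    "num u < num (edge_tau G num e)"
proof -
  have u': "u \<in> cell_verts G c" "edge_iota G num (edge_to G num u) = edge_iota G num e"
    "num (edge_iota G num e) < num u" "num u < num (edge_tau G num e)"
    using u by (auto simp: disrespecters_def)
  then have "u \<in> verts G" using cell_verts_subset by blast
  moreover have "u \<noteq> rt" using num_root_le[OF edge_iota_tau(1)[OF e]] u'(3) by auto
  ultimately have "edge_to G num u \<in> edges G" "edge_tau G num (edge_to G num u) = u"
    using edge_to by auto
  then show "u \<in> cell_verts G c" "edge_to G num u \<in> edges G" "edge_to G num u \<noteq> e"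
    "edge_iota G num (edge_to G num u) = edge_iota G num e" "edge_tau G num (edge_to G num u) = u"
    "num u < num (edge_tau G num e)"
    using u' by auto
qed

text \<open>Two edges lead away from the root at \<open>w\<close>, so \<open>w\<close> is not the
  root, whose degree is 1; the edge from \<open>w\<close> towards the root is then a third
  one.\<close>

lemma edges_at_iota:
  assumes e: "e \<in> edges G" and f: "f \<in> edges G" "f \<noteq> e" "edge_iota G num f = edge_iota G num e"
  defines "w \<equiv> edge_iota G num e"
  obtains p where "w \<in> essential G" "p \<in> edges G" "edge_tau G num p = w" "card {p, f, e} = 3"
    "deg G w = 3 \<longrightarrow> {g \<in> edges G. w \<in> g} = {p, f, e}"
proof -
  have w: "w \<in> verts G" "w \<in> e" "w \<in> f"
    using edge_iota_tau(1,2)[OF e] edge_iota_tau(2)[OF f(1)] f(3) by (auto simp: w_def)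
  have "w \<noteq> rt"
  proof
    assume "w = rt"
    have "card {e, f} \<le> card {g \<in> edges G. w \<in> g}"
      using w e f by (intro card_mono) auto
    then show False using deg_root f(2) \<open>w = rt\<close> by (auto simp: deg_def)
  qed
  define p where "p = edge_to G num w"
  have p: "p \<in> edges G" "edge_tau G num p = w" using edge_to[OF w(1) \<open>w \<noteq> rt\<close>] by (auto simp: p_def)
  have "p \<noteq> e" "p \<noteq> f"
    using edge_iota_tau(8)[OF p(1)] p(2) f(3) by (auto simp: w_def)
  then have c3: "card {p, f, e} = 3" using f(2) by auto
  have sub: "{p, f, e} \<subseteq> {g \<in> edges G. w \<in> g}"
    using p e f w edge_iota_tau(6)[OF p(1)] by auto
  then have "3 \<le> deg G w"
    using c3 card_mono[OF _ sub] by (simp add: deg_def)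
  then have "w \<in> essential G" using w by (simp add: essential_def)
  moreover have "{g \<in> edges G. w \<in> g} = {p, f, e}" if "deg G w = 3"
    using card_subset_eq[OF _ sub] c3 that by (simp add: deg_def)
  ultimately show thesis using that p c3 by blast
qed

lemma disrespecters_nonempty:
  assumes "disrespectful_cell G num n k c" "e \<in> cell_edges G c"
  shows "disrespecter G num c e \<in> disrespecters G num c e"
proof -
  have "\<exists>v. v \<in> disrespecters G num c e"
    using disrespectful_cellD(3)[OF assms]
    unfolding order_disrespecting_def disrespecters_def by blast
  then show ?thesis unfolding disrespecter_def by (rule someI_ex)
qed

lemma iotas_essential:
  assumes "disrespectful_cell G num n k c"
  shows "iotas G num c \<subseteq> essential G"
proof
  fix w assume "w \<in> iotas G num c"
  then obtain e where e: "e \<in> cell_edges G c" "w = edge_iota G num e" by (auto simp: iotas_def)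
  then have eE: "e \<in> edges G" using cell_edges_subset by blast
  note u = disrespectersD[OF eE disrespecters_nonempty[OF assms e(1)]]
  show "w \<in> essential G" unfolding e(2)
    by (rule edges_at_iota[OF eE u(2,3,4)])
qed

text \<open>At a vertex of degree 3 a cell has no choice: the order-disrespecting edge is the last one
  and its disrespecting vertex is the end of the middle one.\<close>

lemma deg3_unique:
  assumes c: "disrespectful_cell G num n k c" "e \<in> cell_edges G c"
    and d: "disrespectful_cell G num n k d" "f \<in> cell_edges G d"
    and eq: "edge_iota G num e = edge_iota G num f" and deg: "deg G (edge_iota G num e) = 3"
  shows "e = f" "disrespecter G num c e = disrespecter G num d f"
proof -
  have eE: "e \<in> edges G" and fE: "f \<in> edges G" using c(2) d(2) cell_edges_subset by blast+
  note u = disrespectersD[OF eE disrespecters_nonempty[OF c]]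
  note v = disrespectersD[OF fE disrespecters_nonempty[OF d]]
  let ?e' = "edge_to G num (disrespecter G num c e)" and ?f' = "edge_to G num (disrespecter G num d f)"
  let ?w = "edge_iota G num e"
  obtain p where p: "p \<in> edges G" "edge_tau G num p = ?w" "{g \<in> edges G. ?w \<in> g} = {p, ?e', e}"
    by (rule edges_at_iota[OF eE u(2,3,4)]) (use deg in blast)
  obtain p' where p': "p' \<in> edges G" "edge_tau G num p' = ?w" "{g \<in> edges G. ?w \<in> g} = {p', ?f', f}"
    by (rule edges_at_iota[OF fE v(2,3,4)]) (use deg eq in auto)
  have "p = p'" using edge_tau_inj p p' by simp
  have "p \<noteq> e" "p \<noteq> ?e'" "p \<noteq> f" "p \<noteq> ?f'"
    using edge_iota_tau(8)[OF p(1)] p(2) u(4) v(4) eq by auto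
  then have "{?e', e} = {p, ?e', e} - {p}" "{?f', f} = {p, ?f', f} - {p}" by auto
  moreover have "{p, ?e', e} = {p, ?f', f}" using p(3) p'(3) \<open>p = p'\<close> eq by simp
  ultimately have "{?e', e} = {?f', f}" by simp
  then have "(e = f \<and> ?e' = ?f') \<or> (e = ?f' \<and> ?e' = f)" by (auto simp: doubleton_eq_iff)
  \<comment> \<open>If the two cells used the two outgoing edges in opposite roles, each of the two
    terminal vertices would have a smaller number than the other.\<close>
  moreover have "\<not> (e = ?f' \<and> ?e' = f)"
  proof
    assume swap: "e = ?f' \<and> ?e' = f"
    then have "num (edge_tau G num e) = num (disrespecter G num d f)"
      "num (edge_tau G num f) = num (disrespecter G num c e)"
      using u(5) v(5) by metis+
    then show False using u(6) v(6) by linarith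
  qed
  ultimately have ef: "e = f" and e'f': "?e' = ?f'" by blast+
  have "edge_tau G num ?e' = edge_tau G num ?f'" by (rule arg_cong[OF e'f'])
  then show "disrespecter G num c e = disrespecter G num d f" unfolding u(5) v(5) .
  show "e = f" by (rule ef)
qed

lemma inj_on_iota:
  assumes "ud_cell G n c"
  shows "inj_on (edge_iota G num) (cell_edges G c)"
proof (rule inj_onI)
  fix e f assume e: "e \<in> cell_edges G c" "f \<in> cell_edges G c" "edge_iota G num e = edge_iota G num f"
  then have "e \<in> edges G" "f \<in> edges G" using cell_edges_subset by blast+
  then have "edge_iota G num e \<in> e \<inter> f"
    using edge_iota_tau(2)[of e] edge_iota_tau(2)[of f] e(3) by simp
  then show "e = f" using cell_edges_disjoint[OF assms e(1,2)] by blast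
qed

lemma inj_on_disrespecter:
  assumes c: "disrespectful_cell G num n k c"
  shows "inj_on (disrespecter G num c) (cell_edges G c)"
proof (rule inj_onI)
  fix e f assume e: "e \<in> cell_edges G c" "f \<in> cell_edges G c" "disrespecter G num c e = disrespecter G num c f"
  have "e \<in> edges G" "f \<in> edges G" using e cell_edges_subset by blast+
  then have "edge_iota G num e = edge_iota G num f"
    using disrespectersD(4)[OF _ disrespecters_nonempty[OF c e(1)]]
      disrespectersD(4)[OF _ disrespecters_nonempty[OF c e(2)]] e(3) by metis
  then show "e = f" using inj_on_iota disrespectful_cellD(1)[OF c] e(1,2) by (metis inj_onD)
qed

lemma disrespecter_subset:
  assumes c: "disrespectful_cell G num n k c"
  shows "disrespecter G num c ` cell_edges G c \<subseteq> cell_verts G c"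
  using disrespecters_nonempty[OF c] by (auto simp: disrespecters_def)

lemma card_iotas:
  assumes c: "disrespectful_cell G num n k c"
  shows "card (iotas G num c) = k"
  unfolding iotas_def
  using card_image[OF inj_on_iota[OF disrespectful_cellD(1)[OF c]]] disrespectful_cellD(2)[OF c]
  by (simp add: cell_dim_def)

lemma card_extras:
  assumes c: "disrespectful_cell G num n k c"
  shows "card (extras G num c) + 2 * k = n"
proof -
  have "card (disrespecter G num c ` cell_edges G c) = k"
    using card_image[OF inj_on_disrespecter[OF c]] disrespectful_cellD(2)[OF c]
    by (simp add: cell_dim_def)
  moreover have "card (extras G num c) = card (cell_verts G c) - card (disrespecter G num c ` cell_edges G c)"
    unfolding extras_def using disrespecter_subset[OF c] finite_cell_edges by (intro card_Diff_subset) auto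
  moreover have "card (disrespecter G num c ` cell_edges G c) \<le> card (cell_verts G c)"
    using disrespecter_subset[OF c] finite_cell_verts by (intro card_mono)
  ultimately show ?thesis
    using card_cell[OF disrespectful_cellD(1)[OF c]] disrespectful_cellD(2)[OF c] by (simp add: cell_dim_def)
qed

lemma extras_Int_iotas:
  assumes c: "disrespectful_cell G num n k c"
  shows "extras G num c \<inter> iotas G num c = {}"
proof -
  have "edge_iota G num e \<notin> cell_verts G c" if "e \<in> cell_edges G c" for e
    using cell_vert_notin_edge[OF disrespectful_cellD(1)[OF c] _ that] edge_iota_tau(2)[of e]
      cell_edges_subset that by blast
  then show ?thesis by (auto simp: extras_def iotas_def)
qed

text \<open>The edge from the initial vertex of \<open>f\<close> to its disrespecting vertex has
  neither end in \<open>e\<close>: one lies in \<open>f\<close>, the other is a vertex of the cell.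
  Edges meet only in vertices, so this edge misses \<open>e\<close>, and it keeps the pair in one
  component.\<close>

lemma disrespecter_component_iff:
  assumes c: "disrespectful_cell G num n k c" and e: "e \<in> cell_edges G c"
    and f: "f \<in> cell_edges G c" "f \<noteq> e" and K: "K \<in> components (points G - e)"
  shows "disrespecter G num c f \<in> K \<longleftrightarrow> f \<subseteq> K" "edge_iota G num f \<in> K \<longleftrightarrow> f \<subseteq> K"
proof -
  have eE: "e \<in> edges G" and fE: "f \<in> edges G" using e f(1) cell_edges_subset by blast+
  note ud = disrespectful_cellD(1)[OF c]
  note i = edge_iota_tau[OF fE]
  have "f \<inter> e = {}" using cell_edges_disjoint[OF ud f(1) e f(2)] .
  then have f_sub: "f \<subseteq> points G - e" using edge_subset_points[OF fE] by blast
  show *: "edge_iota G num f \<in> K \<longleftrightarrow> f \<subseteq> K"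
    using components_maximal[OF K connected_edge[OF fE] f_sub] i(2) by blast
  note u = disrespectersD[OF fE disrespecters_nonempty[OF c f(1)]]
  define g where "g = edge_to G num (disrespecter G num c f)"
  have g: "g \<in> edges G" "g \<inter> verts G = {edge_iota G num f, disrespecter G num c f}"
    using u(2) edge_ends[OF u(2)] u(4,5) by (auto simp: g_def)
  have "disrespecter G num c f \<notin> e" using cell_vert_notin_edge[OF ud u(1) e] .
  moreover have "edge_iota G num f \<notin> e" using i(2) \<open>f \<inter> e = {}\<close> by blast
  ultimately have "(g \<inter> verts G) \<inter> e = {}" and "g \<inter> verts G \<noteq> {}" unfolding g(2) by auto
  then have "g \<inter> e = {}" using edges_meet[OF g(1) eE] by blast
  then have "g \<subseteq> points G - e" using edge_subset_points[OF g(1)] by blast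
  then have "disrespecter G num c f \<in> K \<longleftrightarrow> edge_iota G num f \<in> K"
    using g(2) by (intro component_connected_iff[OF K connected_edge[OF g(1)]]) auto
  then show "disrespecter G num c f \<in> K \<longleftrightarrow> f \<subseteq> K" using * by simp
qed

text \<open>Every edge other than \<open>e\<close> lies in the same component as its disrespecting
  vertex, so the pair counts twice there. The edge \<open>e\<close> lies in no component, and its
  pair contributes only the vertex, which is the \<open>of_bool\<close> term.\<close>

lemma face_count_eq:
  assumes c: "disrespectful_cell G num n k c" and e: "e \<in> cell_edges G c"
    and K: "K \<in> components (points G - e)"
  shows "face_count c e K =
    2 * card (iotas G num c \<inter> K) + of_bool (disrespecter G num c e \<in> K) + card (extras G num c \<inter> K)"
proof -
  define \<F> where "\<F> = {f \<in> cell_edges G c - {e}. f \<subseteq> K}"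
  define \<D> where "\<D> = {f \<in> cell_edges G c. disrespecter G num c f \<in> K}"
  have fin: "finite \<F>" "finite \<D>" using finite_cell_edges by (auto simp: \<F>_def \<D>_def)
  have "edge_iota G num e \<notin> K"
    using in_components_subset[OF K] edge_iota_tau(2)[of e] e cell_edges_subset by blast
  then have "iotas G num c \<inter> K = edge_iota G num ` \<F>"
    using disrespecter_component_iff(2)[OF c e _ _ K] by (auto simp: iotas_def \<F>_def)
  then have I: "card (iotas G num c \<inter> K) = card \<F>"
    using inj_on_iota[OF disrespectful_cellD(1)[OF c]]
    by (simp add: card_image inj_on_subset \<F>_def)
  have "\<D> = \<F> \<union> {f. f = e \<and> disrespecter G num c e \<in> K}"
    using disrespecter_component_iff(1)[OF c e _ _ K] e by (auto simp: \<D>_def \<F>_def)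
  moreover have "e \<notin> \<F>" by (simp add: \<F>_def)
  ultimately have D: "card \<D> = card \<F> + of_bool (disrespecter G num c e \<in> K)"
    using fin by auto
  have "cell_verts G c \<inter> K = (extras G num c \<inter> K) \<union> disrespecter G num c ` \<D>"
    using disrespecter_subset[OF c] by (auto simp: extras_def \<D>_def)
  moreover have "(extras G num c \<inter> K) \<inter> disrespecter G num c ` \<D> = {}"
    by (auto simp: extras_def \<D>_def)
  ultimately have "card (cell_verts G c \<inter> K) = card (extras G num c \<inter> K) + card (disrespecter G num c ` \<D>)"
    using finite_extras fin by (simp add: card_Un_disjoint)
  also have "card (disrespecter G num c ` \<D>) = card \<D>"
    using inj_on_disrespecter[OF c] by (intro card_image) (auto simp: \<D>_def intro: inj_on_subset)
  finally show ?thesis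
    using I D by (simp add: face_count_def \<F>_def)
qed

lemma far_side_counts_differ:
  assumes \<Phi>: "disrespectful_cell G num n k \<Phi>" "one_cell_classes G n k \<Phi> S"
    and \<Psi>: "disrespectful_cell G num n k \<Psi>" "one_cell_classes G n k \<Psi> T"
    and disj: "S \<inter> T = {}"
    and v: "v \<in> iotas G num \<Phi>" "v \<in> iotas G num \<Psi>" "deg G v = 3"
    and nonadj: "\<And>e. \<lbrakk>e \<in> edges G; v \<in> e\<rbrakk> \<Longrightarrow> other_end G e v \<notin> essential G"
  shows "\<exists>f\<in>edges G. v \<in> f \<and>
    2 * int (card (iotas G num \<Phi> \<inter> far_side G v f)) + int (card (extras G num \<Phi> \<inter> far_side G v f)) \<noteq>
    2 * int (card (iotas G num \<Psi> \<inter> far_side G v f)) + int (card (extras G num \<Psi> \<inter> far_side G v f))"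
proof -
  obtain e where e: "e \<in> cell_edges G \<Phi>" "edge_iota G num e = v" using v by (auto simp: iotas_def)
  obtain e' where e': "e' \<in> cell_edges G \<Psi>" "edge_iota G num e' = v" using v by (auto simp: iotas_def)
  have same: "e = e'" "disrespecter G num \<Phi> e = disrespecter G num \<Psi> e'"
    using deg3_unique[OF \<Phi>(1) e(1) \<Psi>(1) e'(1)] e(2) e'(2) v(3) by auto
  have eE: "e \<in> edges G" using e(1) cell_edges_subset by blast
  note \<Phi>D = disrespectful_cellD[OF \<Phi>(1)] and \<Psi>D = disrespectful_cellD[OF \<Psi>(1)]
  obtain K where K: "K \<in> components (points G - e)" "face_count \<Phi> e K \<noteq> face_count \<Psi> e K"
    using disjoint_classes_face_count[OF \<Phi>D(1,2) \<Phi>(2) \<Psi>D(1,2) \<Psi>(2) disj e(1)] e'(1) same(1) by blast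
  obtain a f where a: "a \<in> e" "a \<in> verts G" "f \<in> edges G" "a \<in> f" "f \<noteq> e" "K = branch G a f"
    using component_minus_edge[OF eE K(1)] by blast
  \<comment> \<open>At degree 3 both cells have the same disrespecting vertex for \<open>e\<close>,
    so the \<open>of_bool\<close> terms cancel.\<close>
  have neq: "2 * card (iotas G num \<Phi> \<inter> K) + card (extras G num \<Phi> \<inter> K) \<noteq>
      2 * card (iotas G num \<Psi> \<inter> K) + card (extras G num \<Psi> \<inter> K)"
    using K(2) face_count_eq[OF \<Phi>(1) e(1) K(1)] face_count_eq[OF \<Psi>(1) e'(1)[folded same(1)] K(1)] same
    by simp
  have vV: "v \<in> e" "v \<in> verts G" using edge_iota_tau(1,2)[OF eE] e(2) by auto
  note oe = other_end[OF eE vV]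
  obtain g where g: "g \<in> edges G" "v \<in> g"
    and gK: "\<And>A. \<lbrakk>A \<subseteq> verts G; other_end G e v \<notin> A\<rbrakk> \<Longrightarrow> A \<inter> far_side G v g = A \<inter> K"
  proof (cases "a = v")
    case True
    have "A \<inter> far_side G v f = A \<inter> K" if "A \<subseteq> verts G" for A
      using that verts_Int_branch[of v f] True a(6) by blast
    then show thesis using that a True by blast
  next
    \<comment> \<open>For a component attached at the other end \<open>a\<close> the witness is
      \<open>e\<close> itself: \<open>e\<close> and \<open>f\<close> are the only edges at
      \<open>a\<close>, so the side beyond \<open>e\<close> consists of \<open>a\<close> and
      \<open>K\<close>.\<close>
    case False
    then have a_eq: "a = other_end G e v" using oe(1) a by blast
    have "deg G a \<le> 2" using nonadj[OF eE vV(1)] a(2) a_eq by (simp add: essential_def)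
    moreover have "card {e, f} = 2" using a(5) by auto
    ultimately have at_a: "{g \<in> edges G. a \<in> g} = {e, f}"
      using a eE by (intro card_seteq[symmetric]) (auto simp: deg_def)
    have "points G - {a} = branch G a e \<union> K"
      using branches_cover[OF a(2)] at_a a(6) by simp
    moreover have "branch G a e \<inter> K = {}"
      using branches_disjoint[OF eE a(1,2) a(3,4)] a(5,6) by simp
    moreover have "far_side G v e = points G - branch G a e"
      using points_minus_branch[OF eE a(1,2)] other_end_other_end[OF eE vV] a_eq by simp
    ultimately have "A \<inter> far_side G v e = A \<inter> K" if "A \<subseteq> verts G" "a \<notin> A" for A
      using that verts_subset_points by blast
    then show thesis using that[of e] eE vV(1) a_eq by blast
  qed
  have "other_end G e v \<notin> cell_verts G \<Phi>" "other_end G e v \<notin> cell_verts G \<Psi>"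
    using cell_vert_notin_edge[OF \<Phi>D(1) _ e(1)] cell_vert_notin_edge[OF \<Psi>D(1) _ e'(1)] same(1) oe(4) by blast+
  then have "other_end G e v \<notin> extras G num \<Phi>" "other_end G e v \<notin> extras G num \<Psi>"
    by (auto simp: extras_def)
  moreover have "other_end G e v \<notin> iotas G num \<Phi>" "other_end G e v \<notin> iotas G num \<Psi>"
    using iotas_essential[OF \<Phi>(1)] iotas_essential[OF \<Psi>(1)] nonadj[OF eE vV(1)] by blast+
  ultimately show ?thesis
    using gK[OF iotas_subset] gK[OF extras_subset] neq g
    by (intro bexI[of _ g]) auto
qed

end

section \<open>Construction of the arcs for both parts\<close>

context numbered_tree
begin

text \<open>With \<open>m\<close> edges every essential vertex is an initial vertex in both cells,
  so the doubled counts cancel and only extra vertices can distinguish the cells. An extra vertex is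
  never an initial vertex, so no vertex of degree 3 is an end of an arc. There are at most
  \<open>n - 2 * m\<close> arcs.\<close>

lemma critical_cells_full_dimension:
  assumes \<Phi>: "disrespectful_cell G num n m \<Phi>" "one_cell_classes G n m \<Phi> S"
    and \<Psi>: "disrespectful_cell G num n m \<Psi>" "one_cell_classes G n m \<Psi> T"
    and disj: "S \<inter> T = {}" and m: "m = card (essential G)"
    and nonadj: "\<And>e v. \<lbrakk>e \<in> edges G; v \<in> e; v \<in> essential G\<rbrakk> \<Longrightarrow> other_end G e v \<notin> essential G"
  shows "2 * m + min_allowable G (verts_deg3 G) \<le> n"
proof -
  let ?X = "extras G num \<Phi>" and ?Y = "extras G num \<Psi>"
  have iotas: "iotas G num \<Phi> = essential G" "iotas G num \<Psi> = essential G"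
    using card_subset_eq[OF finite_essential iotas_essential] card_iotas \<Phi>(1) \<Psi>(1) m by metis+
  have cards: "card ?X + 2 * m = n" "card ?Y + 2 * m = n"
    using card_extras \<Phi>(1) \<Psi>(1) by blast+
  define k where "k = card (?X - ?Y)"
  have k: "card (?X - ?Y) = k" "card (?Y - ?X) = k"
  proof -
    have "card (?X - ?Y) = card ?X - card (?X \<inter> ?Y)" "card (?Y - ?X) = card ?Y - card (?X \<inter> ?Y)"
      by (simp_all add: card_Diff_subset_Int finite_extras Int_commute)
    then show "card (?X - ?Y) = k" "card (?Y - ?X) = k" using cards by (auto simp: k_def)
  qed
  have sub: "?X - ?Y \<subseteq> verts G" "?Y - ?X \<subseteq> verts G" "(?X - ?Y) \<inter> (?Y - ?X) = {}"
    using extras_subset by blast+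
  obtain A where A: "\<And>i. i \<in> {1..k} \<Longrightarrow> arc_in G (A i)"
    "bij_betw (\<lambda>i. pathstart (A i)) {1..k} (?X - ?Y)" "bij_betw (\<lambda>i. pathfinish (A i)) {1..k} (?Y - ?X)"
    "\<And>v f. \<lbrakk>v \<in> verts G; f \<in> edges G; v \<in> f\<rbrakk> \<Longrightarrow> (\<Sum>i=1..k. eta G v f (A i)) =
      int (card ((?X - ?Y) \<inter> far_side G v f)) - int (card ((?Y - ?X) \<inter> far_side G v f))"
    using matching_arcs[OF sub k] by blast
  have "allowable G k A (verts_deg3 G)"
    unfolding allowable_def
  proof (intro ballI conjI)
    fix v assume v: "v \<in> verts_deg3 G"
    then have vE: "v \<in> essential G" "v \<in> verts G" "deg G v = 3"
      by (auto simp: essential_def verts_deg3_def)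
    show "v \<notin> arc_ends (A i)" if i: "i \<in> {1..k}" for i
    proof -
      have "pathstart (A i) \<in> ?X" "pathfinish (A i) \<in> ?Y"
        using bij_betw_apply[OF A(2) i] bij_betw_apply[OF A(3) i] by auto
      moreover have "v \<notin> ?X" "v \<notin> ?Y"
        using extras_Int_iotas[OF \<Phi>(1)] extras_Int_iotas[OF \<Psi>(1)] vE(1) iotas by blast+
      ultimately show ?thesis by (auto simp: arc_ends_def)
    qed
    have "v \<in> iotas G num \<Phi>" "v \<in> iotas G num \<Psi>" using iotas vE by auto
    then obtain f where f: "f \<in> edges G" "v \<in> f"
      "card (?X \<inter> far_side G v f) \<noteq> card (?Y \<inter> far_side G v f)"
      using far_side_counts_differ[OF \<Phi> \<Psi> disj _ _ vE(3) nonadj] vE(1) iotas by auto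
    then have "(\<Sum>i=1..k. eta G v f (A i)) \<noteq> 0"
      using A(4)[OF vE(2) f(1,2)] int_card_Diff_cancel[OF finite_extras finite_extras] by simp
    then show "\<exists>e\<in>edges G. v \<in> e \<and> (\<Sum>i=1..k. eta G v e (A i)) \<noteq> 0" using f by blast
  qed
  then have "min_allowable G (verts_deg3 G) \<le> k"
    unfolding min_allowable_def using A(1) by (intro Least_le) blast
  moreover have "k \<le> card ?X" unfolding k_def by (intro card_mono finite_extras) auto
  ultimately show ?thesis using cards by linarith
qed

text \<open>Where the extra vertices are balanced, only the doubled counts of initial vertices can
  differ. The arcs join initial vertices of one cell alone to those of the other alone, so they
  never end in \<open>C\<close>.\<close>

lemma essential_arcs:
  assumes \<Phi>: "disrespectful_cell G num n q \<Phi>" "one_cell_classes G n q \<Phi> S"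
    and \<Psi>: "disrespectful_cell G num n q \<Psi>" "one_cell_classes G n q \<Psi> T"
    and disj: "S \<inter> T = {}"
    and nonadj: "\<And>e v. \<lbrakk>e \<in> edges G; v \<in> e; v \<in> essential G\<rbrakk> \<Longrightarrow> other_end G e v \<notin> essential G"
    and V: "\<V> \<subseteq> iotas G num \<Phi> \<inter> iotas G num \<Psi> \<inter> verts_deg3 G"
    and balanced: "\<And>v f. \<lbrakk>v \<in> \<V>; f \<in> edges G; v \<in> f\<rbrakk> \<Longrightarrow>
      card (extras G num \<Phi> \<inter> far_side G v f) = card (extras G num \<Psi> \<inter> far_side G v f)"
    and enough: "q < card (iotas G num \<Phi> \<inter> iotas G num \<Psi>) + card \<V> \<or>
      iotas G num \<Phi> \<inter> iotas G num \<Psi> \<noteq> iotas G num \<Phi>"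
  defines "C \<equiv> iotas G num \<Phi> \<inter> iotas G num \<Psi>"
  obtains A k where "k \<ge> 1" "k + card C = q" "\<forall>l\<in>{1..k}. arc_in G (A l)" "disjoint_essential_ends G k A"
    "\<forall>l\<in>{1..k}. arc_ends (A l) \<inter> C = {}" "card (C \<inter> verts_deg_gt3 G) \<le> card (high_non_ends G k A)"
    "allowable G k A \<V>"
proof -
  let ?X = "iotas G num \<Phi>" and ?Y = "iotas G num \<Psi>"
  define k where "k = card (?X - ?Y)"
  have cards: "card ?X = q" "card ?Y = q" using card_iotas \<Phi>(1) \<Psi>(1) by blast+
  have k: "card (?X - ?Y) = k" "card (?Y - ?X) = k" and kC: "k + card C = q"
  proof -
    have "card (?X - ?Y) = card ?X - card C" "card (?Y - ?X) = card ?Y - card C" "card C \<le> card ?X"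
      by (simp_all add: card_Diff_subset_Int finite_iotas Int_commute C_def card_mono)
    then show "card (?X - ?Y) = k" "card (?Y - ?X) = k" "k + card C = q"
      using cards by (auto simp: k_def)
  qed
  have sub: "?X - ?Y \<subseteq> verts G" "?Y - ?X \<subseteq> verts G" "(?X - ?Y) \<inter> (?Y - ?X) = {}"
    using iotas_subset by blast+
  obtain A where A: "\<And>i. i \<in> {1..k} \<Longrightarrow> arc_in G (A i)"
    "bij_betw (\<lambda>i. pathstart (A i)) {1..k} (?X - ?Y)" "bij_betw (\<lambda>i. pathfinish (A i)) {1..k} (?Y - ?X)"
    "\<And>v f. \<lbrakk>v \<in> verts G; f \<in> edges G; v \<in> f\<rbrakk> \<Longrightarrow> (\<Sum>i=1..k. eta G v f (A i)) =
      int (card ((?X - ?Y) \<inter> far_side G v f)) - int (card ((?Y - ?X) \<inter> far_side G v f))"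
    using matching_arcs[OF sub k] by blast
  have ends: "pathstart (A i) \<in> ?X - ?Y" "pathfinish (A i) \<in> ?Y - ?X" if "i \<in> {1..k}" for i
    using bij_betw_apply[OF A(2) that] bij_betw_apply[OF A(3) that] by auto
  have ends_C: "\<forall>l\<in>{1..k}. arc_ends (A l) \<inter> C = {}"
    using ends by (fastforce simp: arc_ends_def C_def)
  have "disjoint_essential_ends G k A"
    unfolding disjoint_essential_ends_def
  proof (intro conjI ballI impI)
    fix l assume l: "l \<in> {1..k}"
    show "arc_ends (A l) \<subseteq> essential G"
      using ends[OF l] iotas_essential[OF \<Phi>(1)] iotas_essential[OF \<Psi>(1)] by (auto simp: arc_ends_def)
    show "pathstart (A l) \<noteq> pathfinish (A l)" using ends[OF l] by auto
    fix l' assume l': "l' \<in> {1..k}" "l \<noteq> l'"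
    have "pathstart (A l) \<noteq> pathstart (A l')" "pathfinish (A l) \<noteq> pathfinish (A l')"
      using A(2,3) l l' by (auto simp: bij_betw_def dest: inj_onD)
    moreover have "pathstart (A l) \<noteq> pathfinish (A l')" "pathfinish (A l) \<noteq> pathstart (A l')"
      using ends[OF l] ends[OF l'(1)] by auto
    ultimately show "arc_ends (A l) \<inter> arc_ends (A l') = {}" by (auto simp: arc_ends_def)
  qed
  moreover have "card (C \<inter> verts_deg_gt3 G) \<le> card (high_non_ends G k A)"
    using ends_C by (intro card_mono) (auto simp: high_non_ends_def verts_deg_gt3_def)
  moreover have differ: "\<exists>f\<in>edges G. v \<in> f \<and> card (?X \<inter> far_side G v f) \<noteq> card (?Y \<inter> far_side G v f)"
    if v: "v \<in> \<V>" for v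
  proof -
    have v': "v \<in> ?X" "v \<in> ?Y" "deg G v = 3" "v \<in> essential G"
      using v V by (auto simp: verts_deg3_def essential_def)
    obtain f where f: "f \<in> edges G" "v \<in> f" "2 * int (card (?X \<inter> far_side G v f)) + int (card (extras G num \<Phi> \<inter> far_side G v f)) \<noteq>
        2 * int (card (?Y \<inter> far_side G v f)) + int (card (extras G num \<Psi> \<inter> far_side G v f))"
      using far_side_counts_differ[OF \<Phi> \<Psi> disj v'(1-3) nonadj] v'(4) by blast
    then show ?thesis using balanced[OF v f(1,2)] by (intro bexI[of _ f]) auto
  qed
  have "allowable G k A \<V>"
    unfolding allowable_def
  proof (intro ballI conjI)
    fix v assume v: "v \<in> \<V>"
    show "v \<notin> arc_ends (A i)" if "i \<in> {1..k}" for i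
    proof -
      have "v \<in> C" using v V by (auto simp: C_def)
      then show ?thesis using ends_C that by blast
    qed
    obtain f where f: "f \<in> edges G" "v \<in> f" "card (?X \<inter> far_side G v f) \<noteq> card (?Y \<inter> far_side G v f)"
      using differ[OF v] by blast
    have "v \<in> verts G" using v V by (auto simp: verts_deg3_def)
    then have "(\<Sum>i=1..k. eta G v f (A i)) \<noteq> 0"
      using A(4)[OF _ f(1,2)] int_card_Diff_cancel[OF finite_iotas finite_iotas] f(3) by simp
    then show "\<exists>e\<in>edges G. v \<in> e \<and> (\<Sum>i=1..k. eta G v e (A i)) \<noteq> 0" using f by blast
  qed
  \<comment> \<open>Without arcs both cells would have the same initial vertices; then
    \<open>enough\<close> provides a member of \<open>\<V>\<close>, at which the counts would have
    to differ.\<close>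
  moreover have "k \<ge> 1"
  proof (rule ccontr)
    assume "\<not> k \<ge> 1"
    then have "card (?X - ?Y) = 0" "card (?Y - ?X) = 0" using k by linarith+
    then have "?X - ?Y = {}" "?Y - ?X = {}" using finite_iotas by simp_all
    then have eq: "?X = ?Y" by blast
    then have "card \<V> > 0" using enough cards by simp
    then obtain v where "v \<in> \<V>" by (metis card_gt_0_iff ex_in_conv)
    then show False using differ eq by simp
  qed
  ultimately show thesis using that kC A(1) ends_C by blast
qed

text \<open>The \<open>q - k\<close> common vertices split into \<open>\<W>\<close>,
  \<open>\<W>'\<close> and those of degree above 3. The latter are not ends of arcs, so there are at
  most \<open>r'\<close> of them, which gives the bound on \<open>\<W>\<close>.\<close>

lemma essential_arcs_remaining:
  assumes \<Phi>: "disrespectful_cell G num n q \<Phi>" "one_cell_classes G n q \<Phi> S"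
    and \<Psi>: "disrespectful_cell G num n q \<Psi>" "one_cell_classes G n q \<Psi> T"
    and disj: "S \<inter> T = {}"
    and nonadj: "\<And>e v. \<lbrakk>e \<in> edges G; v \<in> e; v \<in> essential G\<rbrakk> \<Longrightarrow> other_end G e v \<notin> essential G"
    and \<W>: "\<W>' \<subseteq> iotas G num \<Phi> \<inter> iotas G num \<Psi> \<inter> verts_deg3 G"
    and balanced: "\<And>v f. \<lbrakk>v \<in> iotas G num \<Phi> \<inter> iotas G num \<Psi> \<inter> verts_deg3 G - \<W>'; f \<in> edges G; v \<in> f\<rbrakk> \<Longrightarrow>
      card (extras G num \<Phi> \<inter> far_side G v f) = card (extras G num \<Psi> \<inter> far_side G v f)"
    and enough: "int (card \<W>') < int q - int (card (verts_deg_gt3 G))"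
  shows "\<exists>k\<ge>1. \<exists>A r'.
    (\<forall>l\<in>{1..k}. arc_in G (A l)) \<and> disjoint_essential_ends G k A \<and>
    (\<forall>l\<in>{1..k}. arc_ends (A l) \<inter> \<W>' = {}) \<and>
    r' = card (high_non_ends G k A) \<and> r' \<le> card (verts_deg_gt3 G) \<and>
    (\<exists>\<W>\<subseteq>verts_deg3 G. \<W> \<inter> \<W>' = {} \<and>
       int (card \<W>) \<ge> int q - int r' - int k - int (card \<W>') \<and> allowable G k A \<W>)"
proof -
  define C where "C = iotas G num \<Phi> \<inter> iotas G num \<Psi>"
  define \<W> where "\<W> = C \<inter> verts_deg3 G - \<W>'"
  have fin: "finite C" "finite \<W>'" using finite_iotas \<W> finite_subset by (auto simp: C_def)
  have "C \<subseteq> essential G" using iotas_essential[OF \<Phi>(1)] by (auto simp: C_def)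
  then have "C = (C \<inter> verts_deg3 G) \<union> (C \<inter> verts_deg_gt3 G)" using essential_split by blast
  then have "card C = card (C \<inter> verts_deg3 G) + card (C \<inter> verts_deg_gt3 G)"
    using fin deg3_gt3_disjoint card_Un_disjoint[of "C \<inter> verts_deg3 G" "C \<inter> verts_deg_gt3 G"] by auto
  moreover have "card (C \<inter> verts_deg3 G) = card \<W> + card \<W>'"
  proof -
    have "C \<inter> verts_deg3 G = \<W> \<union> \<W>'" using \<W> by (auto simp: \<W>_def C_def)
    moreover have "\<W> \<inter> \<W>' = {}" "finite \<W>" using fin by (auto simp: \<W>_def)
    ultimately show ?thesis using fin by (simp add: card_Un_disjoint)
  qed
  ultimately have card_C: "card C = card \<W> + card \<W>' + card (C \<inter> verts_deg_gt3 G)" by simp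
  have gt3: "card (C \<inter> verts_deg_gt3 G) \<le> card (verts_deg_gt3 G)"
    by (intro card_mono) (auto simp: verts_deg_gt3_def)
  \<comment> \<open>If all initial vertices are common, then \<open>C\<close> has \<open>q\<close>
    members, of which fewer than \<open>q\<close> lie in \<open>\<W>'\<close> or have degree above
    3; so \<open>\<W>\<close> is nonempty.\<close>
  have "q < card C + card \<W> \<or> C \<noteq> iotas G num \<Phi>"
  proof (cases "C = iotas G num \<Phi>")
    case True
    then have "card C = q" using card_iotas[OF \<Phi>(1)] by simp
    then show ?thesis using card_C gt3 enough by simp
  qed simp
  note enough' = this[unfolded C_def]
  have sub: "\<W> \<subseteq> iotas G num \<Phi> \<inter> iotas G num \<Psi> \<inter> verts_deg3 G" by (auto simp: \<W>_def C_def)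
  have "card (extras G num \<Phi> \<inter> far_side G v f) = card (extras G num \<Psi> \<inter> far_side G v f)"
    if "v \<in> \<W>" "f \<in> edges G" "v \<in> f" for v f
    using that balanced unfolding \<W>_def C_def by blast
  note arcs = essential_arcs[OF \<Phi> \<Psi> disj nonadj sub this enough', folded C_def]
  obtain A k where A: "k \<ge> 1" "k + card C = q" "\<forall>l\<in>{1..k}. arc_in G (A l)" "disjoint_essential_ends G k A"
    "\<forall>l\<in>{1..k}. arc_ends (A l) \<inter> C = {}" "card (C \<inter> verts_deg_gt3 G) \<le> card (high_non_ends G k A)"
    "allowable G k A \<W>"
    using arcs by blast
  have "card (high_non_ends G k A) \<le> card (verts_deg_gt3 G)"
    by (intro card_mono) (auto simp: high_non_ends_def verts_deg_gt3_def)
  moreover have "\<forall>l\<in>{1..k}. arc_ends (A l) \<inter> \<W>' = {}" using A(5) \<W> by (auto simp: C_def)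
  moreover have "\<W> \<subseteq> verts_deg3 G" "\<W> \<inter> \<W>' = {}" by (auto simp: \<W>_def)
  moreover have "int (card \<W>) \<ge> int q - int (card (high_non_ends G k A)) - int k - int (card \<W>')"
    using A(2,6) card_C by linarith
  ultimately show ?thesis using A(1,3,4,7) by blast
qed

text \<open>Each cell has a single extra vertex. An edge at \<open>v\<close> that separates the two
  is contained in the arc joining them, so \<open>v\<close> lies on that arc; off the arc the extra
  vertices are balanced.\<close>

lemma extra_vertex_arc:
  assumes \<Phi>: "disrespectful_cell G num n q \<Phi>" "one_cell_classes G n q \<Phi> S"
    and \<Psi>: "disrespectful_cell G num n q \<Psi>" "one_cell_classes G n q \<Psi> T"
    and disj: "S \<inter> T = {}" and n: "n = 2 * q + 1"
    and nonadj: "\<And>e v. \<lbrakk>e \<in> edges G; v \<in> e; v \<in> essential G\<rbrakk> \<Longrightarrow> other_end G e v \<notin> essential G"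
  obtains A0 \<W>' where "arc_in G A0" "\<W>' \<subseteq> arc_interior A0"
    "\<W>' \<subseteq> iotas G num \<Phi> \<inter> iotas G num \<Psi> \<inter> verts_deg3 G"
    "\<And>v f. \<lbrakk>v \<in> iotas G num \<Phi> \<inter> iotas G num \<Psi> \<inter> verts_deg3 G - \<W>'; f \<in> edges G; v \<in> f\<rbrakk> \<Longrightarrow>
      card (extras G num \<Phi> \<inter> far_side G v f) = card (extras G num \<Psi> \<inter> far_side G v f)"
proof -
  have "card (extras G num \<Phi>) = 1" "card (extras G num \<Psi>) = 1"
    using card_extras[OF \<Phi>(1)] card_extras[OF \<Psi>(1)] n by auto
  then obtain x y where x: "extras G num \<Phi> = {x}" and y: "extras G num \<Psi> = {y}"
    by (metis card_1_singletonE)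
  have xy: "x \<in> verts G" "y \<in> verts G" using extras_subset[of \<Phi>] extras_subset[of \<Psi>] x y by auto
  show thesis
  proof (cases "x = y")
    case True
    \<comment> \<open>Equal extra vertices are balanced everywhere, so any arc serves with
      \<open>\<W>'\<close> empty; the degree of the root supplies an edge to use.\<close>
    obtain e where e: "e \<in> edges G"
      using deg_root by (auto simp: deg_def card_1_singleton_iff)
    obtain \<phi> where "arc \<phi>" "path_image \<phi> = e" using edge_arc e by metis
    then have "arc_in G \<phi>" using edge_subset_points[OF e] by (simp add: arc_in_def)
    then show thesis using that[of \<phi> "{}"] x y True by simp
  next
    case False
    then obtain \<gamma> where \<gamma>: "arc_in G \<gamma>" "pathstart \<gamma> = x" "pathfinish \<gamma> = y"
      using arc_between xy by metis
    define \<W>' where "\<W>' = iotas G num \<Phi> \<inter> iotas G num \<Psi> \<inter> verts_deg3 G \<inter> arc_interior \<gamma>"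
    show thesis
    proof (rule that[of \<gamma> \<W>'])
      fix v f assume v: "v \<in> iotas G num \<Phi> \<inter> iotas G num \<Psi> \<inter> verts_deg3 G - \<W>'"
        and f: "f \<in> edges G" "v \<in> f"
      have vV: "v \<in> verts G" using v by (auto simp: verts_deg3_def)
      \<comment> \<open>A common initial vertex is not an extra vertex of either cell, hence not an
        end of the arc; outside \<open>\<W>'\<close> it is therefore off the whole arc.\<close>
      have "v \<noteq> x" "v \<noteq> y"
        using extras_Int_iotas[OF \<Phi>(1)] extras_Int_iotas[OF \<Psi>(1)] x y v by auto
      then have "v \<notin> path_image \<gamma>"
        using v \<gamma> by (auto simp: \<W>'_def arc_interior_def arc_ends_def)
      then have "x \<in> far_side G v f \<longleftrightarrow> y \<in> far_side G v f"
        using arc_covers_edge[OF f vV, of \<gamma>] \<gamma> xy f(2) by (auto simp: arc_in_def arc_imp_path)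
      then show "card (extras G num \<Phi> \<inter> far_side G v f) = card (extras G num \<Psi> \<inter> far_side G v f)"
        by (simp add: x y Int_insert_left)
    qed (use \<gamma> in \<open>auto simp: \<W>'_def\<close>)
  qed
qed

lemma nonadjacent_essential:
  assumes "sufficiently_subdivided G n" "3 \<le> n \<or> card (essential G) \<le> 1"
    and "e \<in> edges G" "v \<in> e" "v \<in> essential G"
  shows "other_end G e v \<notin> essential G"
  using adjacent_essential[OF assms(1,3-5)] assms(2) by linarith

end

theorem proposition3p8:
  fixes G :: "'a::t2_space cw_graph"
    and h :: "'a \<Rightarrow> complex"
    and rt :: 'a
    and num :: "'a \<Rightarrow> nat"
    and m n :: nat
  assumes "is_tree G"
    and "m = card (essential G)" and "m \<ge> 1"
    and "sufficiently_subdivided G n"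
    and "planar_embedding G h"
    and "rt \<in> verts G" and "deg G rt = 1"
    and "dfs_numbering G h rt num"
  shows
    "(verts_deg3 G \<noteq> {} \<longrightarrow> n \<ge> 2 * m \<longrightarrow>
        (\<forall>k \<Phi> \<Psi> S T.
           k = min_allowable G (verts_deg3 G) \<longrightarrow>
           critical_cell G rt num n m \<Phi> \<longrightarrow> critical_cell G rt num n m \<Psi> \<longrightarrow>
           one_cell_classes G n m \<Phi> S \<longrightarrow> one_cell_classes G n m \<Psi> T \<longrightarrow>
           S \<inter> T = {} \<longrightarrow> n \<ge> 2 * m + k))
     \<and>
     (\<forall>q \<epsilon> r s \<Phi> \<Psi> S T.
        \<epsilon> \<in> {0, 1} \<longrightarrow> n = 2 * q + \<epsilon> \<longrightarrow> n < 2 * m \<longrightarrow> q \<ge> 1 \<longrightarrow>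
        r = card (verts_deg_gt3 G) \<longrightarrow> s = card (verts_deg3 G) \<longrightarrow>
        int s < 2 * (int q - int r) \<longrightarrow>
        critical_cell G rt num n q \<Phi> \<longrightarrow> critical_cell G rt num n q \<Psi> \<longrightarrow>
        one_cell_classes G n q \<Phi> S \<longrightarrow> one_cell_classes G n q \<Psi> T \<longrightarrow>
        S \<inter> T = {} \<longrightarrow>
        (\<epsilon> = 0 \<longrightarrow>
           (\<exists>k\<ge>1. \<exists>A r'.
              (\<forall>l\<in>{1..k}. arc_in G (A l)) \<and>
              disjoint_essential_ends G k A \<and>
              r' = card (high_non_ends G k A) \<and> r' \<le> r \<and>
              (\<exists>\<V>\<subseteq>verts_deg3 G. int (card \<V>) \<ge> int q - int r' - int k \<and> allowable G k A \<V>))) \<and>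
        (\<epsilon> = 1 \<longrightarrow>
           (\<exists>A0 \<W>' s'.
              arc_in G A0 \<and>
              \<W>' \<subseteq> verts_deg3 G \<and> \<W>' \<subseteq> arc_interior A0 \<and> s' = card \<W>' \<and> s' \<le> q \<and>
              (int s' < int q - int r \<longrightarrow>
                 (\<exists>k\<ge>1. \<exists>A r'.
                    (\<forall>l\<in>{1..k}. arc_in G (A l)) \<and>
                    disjoint_essential_ends G k A \<and>
                    (\<forall>l\<in>{1..k}. arc_ends (A l) \<inter> \<W>' = {}) \<and>
                    r' = card (high_non_ends G k A) \<and> r' \<le> r \<and>
                    (\<exists>\<W>\<subseteq>verts_deg3 G. \<W> \<inter> \<W>' = {} \<and>
                       int (card \<W>) \<ge> int q - int r' - int k - int s' \<and>
                       allowable G k A \<W>))))))"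
proof -
  interpret numbered_tree G h rt num
    by unfold_locales (fact assms)+
  show ?thesis
  proof (intro conjI allI impI)
    fix k \<Phi> \<Psi> S T
    assume n: "2 * m \<le> n" and k: "k = min_allowable G (verts_deg3 G)"
      and cells: "critical_cell G rt num n m \<Phi>" "critical_cell G rt num n m \<Psi>"
      "one_cell_classes G n m \<Phi> S" "one_cell_classes G n m \<Psi> T" "S \<inter> T = {}"
    have "3 \<le> n \<or> card (essential G) \<le> 1" using n assms(2,3) by linarith
    note nonadj = nonadjacent_essential[OF assms(4) this]
    show "2 * m + k \<le> n"
      unfolding k
      by (rule critical_cells_full_dimension[OF critical_imp_disrespectful[OF cells(1)] cells(3)
          critical_imp_disrespectful[OF cells(2)] cells(4,5) assms(2) nonadj])
  next
    fix q \<epsilon> r s \<Phi> \<Psi> S T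
    assume n: "n = 2 * q + \<epsilon>" "n < 2 * m" "1 \<le> q"
      and rs: "r = card (verts_deg_gt3 G)" "s = card (verts_deg3 G)" "int s < 2 * (int q - int r)"
      and crit: "critical_cell G rt num n q \<Phi>" "critical_cell G rt num n q \<Psi>"
      and cls: "one_cell_classes G n q \<Phi> S" "one_cell_classes G n q \<Psi> T" and disj: "S \<inter> T = {}"
    note cells = critical_imp_disrespectful[OF crit(1)] cls(1) critical_imp_disrespectful[OF crit(2)] cls(2) disj
    have "m = s + r"
      using assms(2) essential_split deg3_gt3_disjoint rs(1,2) finite_essential
        card_Un_disjoint[of "verts_deg3 G" "verts_deg_gt3 G"] by simp
    moreover have srq: "s + 2 * r < 2 * q" using rs(3) by presburger
    \<comment> \<open>For \<open>n\<close> below 3 we have \<open>q\<close> = 1, and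
      \<open>s + 2 * r\<close> < 2 leaves at most one essential vertex.\<close>
    ultimately have "card (essential G) \<le> 1" if "\<not> 3 \<le> n"
      using n(1,3) assms(2) that by linarith
    then have "3 \<le> n \<or> card (essential G) \<le> 1" by blast
    note nonadj = nonadjacent_essential[OF assms(4) this]
    have rq: "r < q" using srq by linarith
    {
      assume "\<epsilon> = 0"
      then have "extras G num \<Phi> = {}" "extras G num \<Psi> = {}"
        using card_extras[OF cells(1)] card_extras[OF cells(3)] n(1) finite_extras by auto
      then have bal: "card (extras G num \<Phi> \<inter> F) = card (extras G num \<Psi> \<inter> F)" for F by simp
      \<comment> \<open>The even case is the construction with \<open>\<W>'\<close> empty, whose
        numerical condition becomes \<open>r\<close> < \<open>q\<close>.\<close>
      have few: "int (card ({} :: 'a set)) < int q - int (card (verts_deg_gt3 G))" using rq rs(1) by simp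
      show "\<exists>k\<ge>1. \<exists>A r'.
              (\<forall>l\<in>{1..k}. arc_in G (A l)) \<and>
              disjoint_essential_ends G k A \<and>
              r' = card (high_non_ends G k A) \<and> r' \<le> r \<and>
              (\<exists>\<V>\<subseteq>verts_deg3 G. int (card \<V>) \<ge> int q - int r' - int k \<and> allowable G k A \<V>)"
        using essential_arcs_remaining[OF cells nonadj empty_subsetI bal few] unfolding rs(1) by simp
    next
      assume "\<epsilon> = 1"
      with n have "n = 2 * q + 1" by simp
      then obtain A0 \<W>' where W: "arc_in G A0" "\<W>' \<subseteq> arc_interior A0"
        "\<W>' \<subseteq> iotas G num \<Phi> \<inter> iotas G num \<Psi> \<inter> verts_deg3 G"
        "\<And>v f. \<lbrakk>v \<in> iotas G num \<Phi> \<inter> iotas G num \<Psi> \<inter> verts_deg3 G - \<W>'; f \<in> edges G; v \<in> f\<rbrakk> \<Longrightarrow>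
          card (extras G num \<Phi> \<inter> far_side G v f) = card (extras G num \<Psi> \<inter> far_side G v f)"
        using extra_vertex_arc[OF cells _ nonadj] by blast
      have "card \<W>' \<le> card (iotas G num \<Phi>)" using W(3) finite_iotas by (intro card_mono) auto
      then have le: "card \<W>' \<le> q" using card_iotas[OF cells(1)] by simp
      have deg3: "\<W>' \<subseteq> verts_deg3 G" using W(3) by blast
      show "\<exists>A0 \<W>' s'.
              arc_in G A0 \<and>
              \<W>' \<subseteq> verts_deg3 G \<and> \<W>' \<subseteq> arc_interior A0 \<and> s' = card \<W>' \<and> s' \<le> q \<and>
              (int s' < int q - int r \<longrightarrow>
                 (\<exists>k\<ge>1. \<exists>A r'.
                    (\<forall>l\<in>{1..k}. arc_in G (A l)) \<and>
                    disjoint_essential_ends G k A \<and>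
                    (\<forall>l\<in>{1..k}. arc_ends (A l) \<inter> \<W>' = {}) \<and>
                    r' = card (high_non_ends G k A) \<and> r' \<le> r \<and>
                    (\<exists>\<W>\<subseteq>verts_deg3 G. \<W> \<inter> \<W>' = {} \<and>
                       int (card \<W>) \<ge> int q - int r' - int k - int s' \<and>
                       allowable G k A \<W>)))"
        using essential_arcs_remaining[OF cells nonadj W(3,4)] unfolding rs(1)
        by (intro exI[of _ A0] exI[of _ "\<W>'"] exI[of _ "card \<W>'"]
            conjI[OF W(1)] conjI[OF deg3] conjI[OF W(2)] conjI[OF refl] conjI[OF le]) (rule impI)
    }
  qed
qed

end
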